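(* In the setting described in the context (problem $\min F=f+r$, assumptions (B1)–(B6), $\lambda>0$ with $\lambda(\tau+\rho)<1$, step-sizes $\{\eta_t\}_{t\ge0}\subseteq(0,\frac{\lambda}{1+\lambda M})$, iteration count $T$), assume $F$ attains its minimum. Then the random point $x_{t^*}$ returned by the stochastic mirror descent algorithm satisfies $$\mathbb{E}\left[ D_{\Phi}\left(\mathrm{prox}_{\lambda F}^\Phi (x_{t^*}),x_{t^*}\right) \right] \le \frac{\lambda}{1-(\tau+\rho)\lambda} \left( \frac{\lambda(F^\Phi_\lambda(x_0) - \min F)}{ \sum_{t=0}^T \frac{\eta_t}{1-\eta_t\rho}} + \frac{\sigma^2 \sum_{t=0}^T \frac{ \eta_t^2 }{(1- \eta_t(M+ 1/\lambda ))(1-\eta_t\rho)} } { 4 \sum_{t=0}^T \frac{\eta_t }{1-\eta_t\rho}} \right).$$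
   Context: Legendre functions. $\Phi\colon\mathbb{R}^d\to\mathbb{R}\cup\{\infty\}$ is a Legendre function: it is proper, closed, strictly convex; $U:=\mathrm{int}(\mathrm{dom}\,\Phi)$ is nonempty; $\Phi$ is differentiable on $U$; and $\|\nabla\Phi(x_k)\|\to\infty$ for any sequence $\{x_k\}\subset U$ converging to a boundary point of $\mathrm{dom}\,\Phi$. Its Bregman divergence is $D_\Phi(y,x)=\Phi(y)-\Phi(x)-\langle\nabla\Phi(x),y-x\rangle$ for $x\in U$, $y\in\mathrm{dom}\,\Phi$. A function $g$ is $\rho$-weakly convex relative to $\Phi$ if $g+\rho\Phi$ is convex. Problem. $\min_x F(x):=f(x)+r(x)$, where $f\colon\mathbb{R}^d\to\mathbb{R}$ is locally Lipschitz (and differentiable at the points where $\nabla f$ appears below), $r\colon\mathbb{R}^d\to\mathbb{R}\cup\{\infty\}$ is closed with convex domain, and $\mathrm{ri}(\mathrm{dom}\,r)\subseteq U$ and $\partial(r+\Phi)(x)=\emptyset$ for all $x\notin U$. Here $\partial$ is the limiting subdifferential: $v\in\partial g(x)$ iff there are $x_k\to x$ with $g(x_k)\to g(x)$ and $v_k\to v$ with $v_k\in\hat\partial g(x_k)$, where $\hat\partial g(x)=\{v: g(y)\ge g(x)+\langle v,y-x\rangle+o(\|y-x\|)\text{ as }y\to x\}$. Assumptions. $(\Omega,\mathcal{F},P)$ is a probability space. (B1) i.i.d. samples $\xi_0,\xi_1,\ldots\sim P$ can be generated. (B2) There is a measurable mapping $G\colon U\times\Omega\to\mathbb{R}^d$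 with $\mathbb{E}_\xi[G(x,\xi)]=\nabla f(x)$ for all $x\in U\cap\mathrm{dom}\,r$. (B3) There are reals $\tau,M\ge0$ with $-\tau D_\Phi(y,x)\le f(y)-f(x)-\langle\nabla f(x),y-x\rangle\le M D_\Phi(y,x)$ for all $x,y\in U\cap\mathrm{dom}\,r$. (B4) $r$ is $\rho$-weakly convex relative to $\Phi$, with $\rho\ge0$. (B5) $\Phi$ is $1$-strongly convex with respect to some norm $\|\cdot\|$, so that $D_\Phi(y,x)\ge\frac12\|y-x\|^2$; $\|\cdot\|_*$ denotes the dual norm. (B6) $\mathbb{E}_\xi[\|G(x,\xi)-\nabla f(x)\|_*^2]\le\frac{\sigma^2}{2}<\infty$ for all $x\in U\cap\mathrm{dom}\,r$. Envelope and proximal map. $F_\lambda^\Phi(x):=\inf_y\{F(y)+\frac1\lambda D_\Phi(y,x)\}$ and $\mathrm{prox}_{\lambda F}^\Phi(x):=\mathrm{argmin}_y\{F(y)+\frac1\lambda D_\Phi(y,x)\}$. Algorithm (stochastic mirror descent). Input: $x_0\in U\cap\mathrm{dom}\,r$, $\lambda>0$ with $\lambda<(\tau+\rho)^{-1}$, a sequence $\{\eta_t\}_{t\ge0}\subseteq(0,\frac{\lambda}{1+\lambda M})$, iteration count $T$. For $t=0,\ldots,T$: sample $\xi_t\sim P$ (independently) and set $x_{t+1}=\mathrm{argmin}_x\{\langle G(x_t,\xi_t),x\rangle+r(x)+\frac1{\eta_t}D_\Phi(x,x_t)\}$. Then sample $t^*\in\{0,\ldots,T\}$, independently of the $\xi_t$,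 with $\mathbb{P}(t^*=t)\propto\frac{\eta_t}{1-\eta_t\rho}$ and return $x_{t^*}$. The expectation is over all randomness. *)

theory Defs
  imports "HOL-Probability.Probability"
begin

text \<open>Functions with values in the reals extended by plus infinity are \<open>ereal\<close>-valued functions
  that never take the value \<open>-\<infinity>\<close>. On their effective domain they are real-valued, and there
  \<^const>\<open>real_of_ereal\<close> is faithful.\<close>

definition effective_domain :: "('a \<Rightarrow> ereal) \<Rightarrow> 'a set" where
  "effective_domain g = {x. g x < \<infinity>}"

definition closed_function :: "('a::euclidean_space \<Rightarrow> ereal) \<Rightarrow> bool" where
  "closed_function g \<longleftrightarrow> closed (epigraph (effective_domain g) (\<lambda>x. real_of_ereal (g x)))"

definition convex_function :: "('a::euclidean_space \<Rightarrow> ereal) \<Rightarrow> bool" where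
  "convex_function g \<longleftrightarrow> convex_on (effective_domain g) (\<lambda>x. real_of_ereal (g x))"

definition strictly_convex_function :: "('a::euclidean_space \<Rightarrow> ereal) \<Rightarrow> bool" where
  "strictly_convex_function g \<longleftrightarrow>
     (\<forall>x\<in>effective_domain g. \<forall>y\<in>effective_domain g. \<forall>u. x \<noteq> y \<and> 0 < u \<and> u < 1 \<longrightarrow>
        g ((1 - u) *\<^sub>R x + u *\<^sub>R y) < ereal (1 - u) * g x + ereal u * g y)"

definition grad :: "('a::euclidean_space \<Rightarrow> real) \<Rightarrow> 'a \<Rightarrow> 'a" where
  "grad h x = (THE v. GDERIV h x :> v)"

abbreviation egrad :: "('a::euclidean_space \<Rightarrow> ereal) \<Rightarrow> 'a \<Rightarrow> 'a" where
  "egrad g \<equiv> grad (\<lambda>x. real_of_ereal (g x))"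

definition legendre :: "('a::euclidean_space \<Rightarrow> ereal) \<Rightarrow> bool" where
  "legendre \<Phi> \<longleftrightarrow>
     (\<forall>x. \<Phi> x \<noteq> -\<infinity>) \<and> effective_domain \<Phi> \<noteq> {} \<and>
     closed_function \<Phi> \<and> strictly_convex_function \<Phi> \<and>
     interior (effective_domain \<Phi>) \<noteq> {} \<and>
     (\<forall>x\<in>interior (effective_domain \<Phi>). (\<lambda>y. real_of_ereal (\<Phi> y)) differentiable at x) \<and>
     (\<forall>X x. (\<forall>k. X k \<in> interior (effective_domain \<Phi>)) \<and> X \<longlonglongrightarrow> x \<and>
        x \<in> frontier (effective_domain \<Phi>) \<longrightarrow>
        filterlim (\<lambda>k. norm (egrad \<Phi> (X k))) at_top sequentially)"

text \<open>The value is \<open>\<infinity>\<close> for \<open>y\<close> outside the domain of \<open>\<Phi>\<close>; it is meaningful only for \<open>x\<close> in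
  the interior of that domain.\<close>

definition bregman :: "('a::euclidean_space \<Rightarrow> ereal) \<Rightarrow> 'a \<Rightarrow> 'a \<Rightarrow> ereal" where
  "bregman \<Phi> y x = \<Phi> y - \<Phi> x - ereal (egrad \<Phi> x \<bullet> (y - x))"

text \<open>For \<open>\<rho> = 0\<close> this is convexity of \<open>g\<close>, since \<open>0 * \<infinity> = 0\<close> in \<open>ereal\<close>.\<close>

definition weakly_convex_relative ::
    "real \<Rightarrow> ('a::euclidean_space \<Rightarrow> ereal) \<Rightarrow> ('a \<Rightarrow> ereal) \<Rightarrow> bool" where
  "weakly_convex_relative \<rho> g \<Phi> \<longleftrightarrow> convex_function (\<lambda>x. g x + ereal \<rho> * \<Phi> x)"

definition is_norm :: "('a::real_vector \<Rightarrow> real) \<Rightarrow> bool" where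
  "is_norm N \<longleftrightarrow> (\<forall>x. 0 \<le> N x) \<and> (\<forall>x. N x = 0 \<longleftrightarrow> x = 0) \<and>
     (\<forall>c x. N (c *\<^sub>R x) = \<bar>c\<bar> * N x) \<and> (\<forall>x y. N (x + y) \<le> N x + N y)"

definition dual_norm :: "('a::euclidean_space \<Rightarrow> real) \<Rightarrow> 'a \<Rightarrow> real" where
  "dual_norm N v = (SUP x\<in>{x. N x \<le> 1}. v \<bullet> x)"

definition strongly_convex_function ::
    "real \<Rightarrow> ('a::euclidean_space \<Rightarrow> real) \<Rightarrow> ('a \<Rightarrow> ereal) \<Rightarrow> bool" where
  "strongly_convex_function \<mu> N g \<longleftrightarrow>
     (\<forall>x\<in>effective_domain g. \<forall>y\<in>effective_domain g. \<forall>u. 0 \<le> u \<and> u \<le> 1 \<longrightarrow>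
        g ((1 - u) *\<^sub>R x + u *\<^sub>R y) + ereal (\<mu> / 2 * u * (1 - u) * (N (y - x))\<^sup>2)
          \<le> ereal (1 - u) * g x + ereal u * g y)"

text \<open>Both subdifferentials are empty at points where the function is not finite.\<close>

definition frechet_subdifferential :: "('a::euclidean_space \<Rightarrow> ereal) \<Rightarrow> 'a \<Rightarrow> 'a set" where
  "frechet_subdifferential g x = {v. \<bar>g x\<bar> \<noteq> \<infinity> \<and>
     (\<forall>\<epsilon>>0. \<forall>\<^sub>F y in at x. g x + ereal (v \<bullet> (y - x) - \<epsilon> * norm (y - x)) \<le> g y)}"

definition limiting_subdifferential :: "('a::euclidean_space \<Rightarrow> ereal) \<Rightarrow> 'a \<Rightarrow> 'a set" where
  "limiting_subdifferential g x = {v. \<bar>g x\<bar> \<noteq> \<infinity> \<and>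
     (\<exists>X V. X \<longlonglongrightarrow> x \<and> (\<lambda>k. g (X k)) \<longlonglongrightarrow> g x \<and> V \<longlonglongrightarrow> v \<and>
        (\<forall>k. V k \<in> frechet_subdifferential g (X k)))}"

definition locally_lipschitz :: "('a::metric_space \<Rightarrow> real) \<Rightarrow> bool" where
  "locally_lipschitz f \<longleftrightarrow> (\<forall>x. \<exists>\<delta>>0. \<exists>L. L-lipschitz_on (ball x \<delta>) f)"

definition objective :: "('a \<Rightarrow> real) \<Rightarrow> ('a \<Rightarrow> ereal) \<Rightarrow> 'a \<Rightarrow> ereal" where
  "objective f r x = ereal (f x) + r x"

definition bregman_envelope ::
    "('a::euclidean_space \<Rightarrow> ereal) \<Rightarrow> real \<Rightarrow> ('a \<Rightarrow> ereal) \<Rightarrow> 'a \<Rightarrow> ereal" where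
  "bregman_envelope \<Phi> lam F x = (INF y. F y + ereal (1 / lam) * bregman \<Phi> y x)"

definition bregman_prox ::
    "('a::euclidean_space \<Rightarrow> ereal) \<Rightarrow> real \<Rightarrow> ('a \<Rightarrow> ereal) \<Rightarrow> 'a \<Rightarrow> 'a" where
  "bregman_prox \<Phi> lam F x = arg_min (\<lambda>y. F y + ereal (1 / lam) * bregman \<Phi> y x) (\<lambda>_. True)"

text \<open>The iterates for a given realization \<open>s\<close> of the sequence of samples.\<close>

primrec smd_iterate ::
    "('a::euclidean_space \<Rightarrow> ereal) \<Rightarrow> ('a \<Rightarrow> ereal) \<Rightarrow> ('a \<Rightarrow> 'w \<Rightarrow> 'a) \<Rightarrow> (nat \<Rightarrow> real) \<Rightarrow> 'a \<Rightarrow>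
     (nat \<Rightarrow> 'w) \<Rightarrow> nat \<Rightarrow> 'a" where
  "smd_iterate \<Phi> r G \<eta> x0 s 0 = x0"
| "smd_iterate \<Phi> r G \<eta> x0 s (Suc t) =
     arg_min (\<lambda>y. ereal (G (smd_iterate \<Phi> r G \<eta> x0 s t) (s t) \<bullet> y) + r y
                   + ereal (1 / \<eta> t) * bregman \<Phi> y (smd_iterate \<Phi> r G \<eta> x0 s t)) (\<lambda>_. True)"

end

theory Submission
  imports Defs
begin

text \<open>
  The proof follows the Bregman envelope
  \<open>E(x) = min\<^sub>y F(y) + D(y, x) / lam\<close> along the iterates. Let \<open>z\<close> be the proximal point of
  \<open>x\<close> and let \<open>y\<close> be the next iterate, computed with the stochastic gradient \<open>v\<close>. Three
  inequalities are added: the growth of the step's subproblem away from its minimizer \<open>y\<close>,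
  tested at \<open>z\<close>; the relative smoothness of \<open>f\<close> from \<open>x\<close> to \<open>y\<close>; and its relative weak
  convexity from \<open>x\<close> to \<open>z\<close>. Minimality of \<open>z\<close> bounds \<open>F(y) - F(z)\<close> below by a difference
  of divergences from \<open>x\<close>, so that only divergences and the noise \<open>\<nabla>f(x) - v\<close> remain
  (\<open>step_descent\<close>). The noise is paired with \<open>y - z = (y - x) + (x - z)\<close>. Its pairing with
  \<open>x - z\<close> has mean zero, because \<open>v\<close> is unbiased and drawn after \<open>x\<close> and \<open>z\<close> are determined; its
  pairing with \<open>y - x\<close> is absorbed by the slack \<open>1 / \<eta> - M - 1 / lam\<close> in front of
  \<open>D(y, x)\<close>, at the price of a variance term. Since \<open>z\<close> is a candidate in the definition of
  \<open>E(y)\<close>, this says that \<open>E\<close> decreases in expectation by a multiple of \<open>D(z, x)\<close>, up to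
  variance (\<open>expected_envelope_descent\<close>). The decrease telescopes, \<open>E\<close> is bounded below by
  \<open>min F\<close>, and the distribution of the returned index turns the weighted sum of the expected
  divergences into the expectation in the theorem.

  Beneath this lies the well-posedness of the subproblems. Both the proximal map and the
  mirror step minimize \<open>\<alpha> \<Phi> + r + q - \<langle>c, \<cdot>\<rangle>\<close>, with \<open>q = f\<close> and \<open>q = 0\<close> respectively, and
  they are treated together in the locale \<open>prox_model\<close>. Coercivity gives a minimizer. It lies in
  \<open>U = int (dom \<Phi>)\<close>, because a Legendre function enters its domain from a boundary point with
  slope \<open>-\<infinity>\<close> (\<open>steep_at_boundary\<close>), whereas the remaining terms have slopes that are bounded
  above. At an interior minimizer the first-order condition yields a growth inequality
  (\<open>minimizer_growth\<close>), hence uniqueness and Lipschitz dependence on \<open>c\<close>; the latter makes the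
  iterates measurable functions of the samples. Apart from the mean of the stochastic gradient at
  a fixed point, all expectations are integrals of nonnegative functions, so independence enters
  only through Tonelli's theorem.
\<close>

section \<open>Norms on Euclidean spaces and their duals\<close>

lemma is_normD:
  assumes "is_norm N"
  shows "0 \<le> N x" "N 0 = 0" "x \<noteq> 0 \<Longrightarrow> 0 < N x" "N (c *\<^sub>R x) = \<bar>c\<bar> * N x"
    "N (x + y) \<le> N x + N y"
  using assms unfolding is_norm_def by (auto simp: less_le)

lemma is_norm_convex: "is_norm N \<Longrightarrow> convex_on UNIV N"
proof (rule convex_onI)
  fix t :: real and x y :: 'a
  assume N: "is_norm N" and t: "0 < t" "t < 1"
  have "N ((1 - t) *\<^sub>R x + t *\<^sub>R y) \<le> N ((1 - t) *\<^sub>R x) + N (t *\<^sub>R y)"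
    by (rule is_normD[OF N])
  also have "\<dots> = (1 - t) * N x + t * N y"
    using t by (simp add: is_normD[OF N])
  finally show "N ((1 - t) *\<^sub>R x + t *\<^sub>R y) \<le> (1 - t) * N x + t * N y" .
qed auto

lemma is_norm_continuous:
  fixes N :: "'a::euclidean_space \<Rightarrow> real"
  shows "is_norm N \<Longrightarrow> continuous_on UNIV N"
  by (intro convex_on_continuous is_norm_convex) auto

lemma is_norm_bounds_norm:
  fixes N :: "'a::euclidean_space \<Rightarrow> real"
  assumes N: "is_norm N"
  obtains k where "k > 0" "\<And>x. k * norm x \<le> N x"
proof -
  obtain b :: 'a where b: "b \<in> Basis"
    using nonempty_Basis by blast
  have "\<exists>x\<in>sphere 0 1. \<forall>y\<in>sphere (0::'a) 1. N x \<le> N y"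
  proof (rule continuous_attains_inf)
    show "sphere (0::'a) 1 \<noteq> {}" using b by (auto intro!: exI[of _ b])
    show "continuous_on (sphere 0 1) N"
      using is_norm_continuous[OF N] continuous_on_subset by blast
  qed auto
  then obtain x0 where x0: "norm x0 = 1" "\<And>y. norm y = 1 \<Longrightarrow> N x0 \<le> N y"
    by auto
  have "x0 \<noteq> 0" using x0(1) by auto
  then have pos: "N x0 > 0" by (intro is_normD[OF N])
  have "N x0 * norm x \<le> N x" for x
  proof (cases "x = 0")
    case True
    then show ?thesis by (simp add: is_normD[OF N])
  next
    case False
    then have "N x0 \<le> N ((1 / norm x) *\<^sub>R x)" by (intro x0) auto
    also have "\<dots> = N x / norm x" by (simp add: is_normD[OF N])
    finally show ?thesis using False by (simp add: field_simps)
  qed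
  with pos show ?thesis by (rule that)
qed

lemma dual_norm_bdd_above:
  fixes N :: "'a::euclidean_space \<Rightarrow> real"
  assumes N: "is_norm N"
  shows "bdd_above ((\<lambda>x. v \<bullet> x) ` {x. N x \<le> 1})"
proof -
  obtain k where k: "k > 0" "\<And>x. k * norm x \<le> N x"
    using is_norm_bounds_norm[OF N] by blast
  have "v \<bullet> x \<le> norm v / k" if "N x \<le> 1" for x
  proof -
    have "norm x \<le> 1 / k" using k(2)[of x] that k(1) by (simp add: field_simps)
    then have "norm v * norm x \<le> norm v * (1 / k)" by (intro mult_left_mono) auto
    then show ?thesis using norm_cauchy_schwarz[of v x] by simp
  qed
  then show ?thesis by (intro bdd_aboveI2) auto
qed

lemma dual_norm_upper:
  fixes N :: "'a::euclidean_space \<Rightarrow> real"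
  shows "is_norm N \<Longrightarrow> N x \<le> 1 \<Longrightarrow> v \<bullet> x \<le> dual_norm N v"
  unfolding dual_norm_def by (intro cSUP_upper dual_norm_bdd_above) auto

lemma inner_le_dual_norm:
  fixes N :: "'a::euclidean_space \<Rightarrow> real"
  assumes N: "is_norm N"
  shows "v \<bullet> x \<le> dual_norm N v * N x"
proof (cases "x = 0")
  case True
  then show ?thesis by (simp add: is_normD[OF N])
next
  case False
  then have pos: "N x > 0" by (intro is_normD[OF N])
  have "v \<bullet> ((1 / N x) *\<^sub>R x) \<le> dual_norm N v"
    using pos by (intro dual_norm_upper N) (simp add: is_normD[OF N])
  then show ?thesis using pos by (simp add: field_simps)
qed

lemma dual_norm_convex:
  fixes N :: "'a::euclidean_space \<Rightarrow> real"
  assumes N: "is_norm N"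
  shows "convex_on UNIV (dual_norm N)"
proof (rule convex_onI)
  fix t :: real and v w :: 'a
  assume t: "0 < t" "t < 1"
  have ne: "{x. N x \<le> 1} \<noteq> {}" by (auto simp: is_normD[OF N] intro!: exI[of _ 0])
  show "dual_norm N ((1 - t) *\<^sub>R v + t *\<^sub>R w) \<le> (1 - t) * dual_norm N v + t * dual_norm N w"
    unfolding dual_norm_def[of N "(1 - t) *\<^sub>R v + t *\<^sub>R w"]
  proof (rule cSUP_least[OF ne])
    fix x assume "x \<in> {x. N x \<le> 1}"
    then show "((1 - t) *\<^sub>R v + t *\<^sub>R w) \<bullet> x \<le> (1 - t) * dual_norm N v + t * dual_norm N w"
      using t dual_norm_upper[OF N, of x v] dual_norm_upper[OF N, of x w]
      by (auto simp: inner_add_left intro!: add_mono mult_left_mono)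
  qed
qed auto

lemma dual_norm_measurable:
  fixes N :: "'a::euclidean_space \<Rightarrow> real"
  assumes "is_norm N"
  shows "dual_norm N \<in> borel_measurable borel"
  by (intro borel_measurable_continuous_onI convex_on_continuous dual_norm_convex assms) auto

section \<open>Closed functions and directional derivatives\<close>

text \<open>A sequence along which \<open>g\<close> tends to \<open>-\<infinity>\<close> would accumulate at a point above which the closed
  epigraph contains an entire vertical line.\<close>

lemma closed_epigraph_bounded_below:
  fixes g :: "'a::euclidean_space \<Rightarrow> real"
  assumes cl: "closed (epigraph S g)" and B: "bounded B"
  obtains m where "\<And>y. y \<in> B \<Longrightarrow> y \<in> S \<Longrightarrow> m \<le> g y"
proof (rule ccontr)
  assume "\<not> thesis"
  then have "\<forall>n::nat. \<exists>y. y \<in> B \<and> y \<in> S \<and> g y < - real n"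
    using that by (meson not_le)
  then obtain Y where Y: "\<And>n. Y n \<in> B" "\<And>n. Y n \<in> S" "\<And>n. g (Y n) < - real n"
    by metis
  have "bounded (range Y)" using B by (rule bounded_subset) (auto simp: Y)
  then obtain l s where s: "strict_mono s" and l: "(Y \<circ> s) \<longlonglongrightarrow> l"
    using bounded_imp_convergent_subsequence by blast
  have "(l, - m) \<in> epigraph S g" if m: "m \<ge> 0" for m
  proof (rule Lim_in_closed_set[OF cl])
    show "(\<lambda>n. (Y (s n), - m)) \<longlonglongrightarrow> (l, - m)"
      using l by (intro tendsto_Pair) (auto simp: o_def)
    show "\<forall>\<^sub>F n in sequentially. (Y (s n), - m) \<in> epigraph S g"
      using eventually_ge_at_top[of "nat \<lceil>m\<rceil>"]
    proof eventually_elim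
      case (elim n)
      then have "m \<le> real (s n)" using seq_suble[OF s, of n] by linarith
      then show ?case using Y(2,3)[of "s n"] by (simp add: mem_epigraph)
    qed
  qed auto
  from this[of "\<bar>g l\<bar> + 1"] have "g l \<le> - (\<bar>g l\<bar> + 1)" by (simp add: mem_epigraph)
  then show False by linarith
qed

text \<open>Lower semicontinuity of the two convex summands is given through their epigraphs. Minimizing
  \<open>\<alpha> * a + b + q y\<close> over triples with \<open>(y, a)\<close> and \<open>(y, b)\<close> in the epigraphs avoids having to
  show that the sum is closed: the objective is then continuous and the constraint set is
  compact.\<close>

lemma sum_attains_min_on_compact:
  fixes g h q :: "'a::euclidean_space \<Rightarrow> real"
  assumes g: "closed (epigraph S g)" and h: "closed (epigraph R h)"
    and q: "continuous_on UNIV q" and \<alpha>: "\<alpha> > 0" and B: "compact B"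
    and w: "w \<in> B" "w \<in> S" "w \<in> R"
  obtains y where "y \<in> B" "y \<in> S" "y \<in> R"
    "\<And>z. z \<in> B \<Longrightarrow> z \<in> S \<Longrightarrow> z \<in> R \<Longrightarrow> \<alpha> * g y + h y + q y \<le> \<alpha> * g z + h z + q z"
proof -
  have Bb: "bounded B" using B compact_imp_bounded by blast
  obtain m1 where m1: "\<And>y. y \<in> B \<Longrightarrow> y \<in> S \<Longrightarrow> m1 \<le> g y"
    using closed_epigraph_bounded_below[OF g Bb] by blast
  obtain m2 where m2: "\<And>y. y \<in> B \<Longrightarrow> y \<in> R \<Longrightarrow> m2 \<le> h y"
    using closed_epigraph_bounded_below[OF h Bb] by blast
  obtain x where x: "x \<in> B" "\<And>y. y \<in> B \<Longrightarrow> q x \<le> q y"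
    using continuous_attains_inf[OF B, of q] w(1) continuous_on_subset[OF q] by blast
  define v where "v = \<alpha> * g w + h w + q w"
  define M1 where "M1 = (v - q x - m2) / \<alpha>"
  define M2 where "M2 = v - q x - \<alpha> * m1"
  define \<Psi> :: "'a \<times> real \<times> real \<Rightarrow> real" where
    "\<Psi> p = \<alpha> * fst (snd p) + snd (snd p) + q (fst p)" for p
  have \<Psi>: "continuous_on UNIV \<Psi>"
    unfolding \<Psi>_def
    by (intro continuous_intros continuous_on_compose2[OF q]) auto
  define E where "E = (\<lambda>p. (fst p, fst (snd p))) -` epigraph S g \<inter>
     (\<lambda>p. (fst p, snd (snd p))) -` epigraph R h \<inter> {p. \<Psi> p \<le> v}"
  have "closed E"
    unfolding E_def
    by (intro closed_Int closed_vimage g h closed_Collect_le \<Psi> continuous_intros)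
  moreover have "compact (B \<times> {m1..M1} \<times> {m2..M2})"
    by (intro compact_Times B compact_Icc)
  ultimately have "compact (B \<times> {m1..M1} \<times> {m2..M2} \<inter> E)"
    by (rule compact_Int_closed[rotated])
  moreover have mem: "(y, g y, h y) \<in> B \<times> {m1..M1} \<times> {m2..M2} \<inter> E"
    if y: "y \<in> B" "y \<in> S" "y \<in> R" "\<alpha> * g y + h y + q y \<le> v" for y
  proof -
    have "\<alpha> * g y \<le> v - q x - m2" using y x(2)[of y] m2[of y] by linarith
    then have "g y \<le> M1" using \<alpha> by (simp add: M1_def field_simps)
    moreover have "\<alpha> * m1 \<le> \<alpha> * g y" using m1[of y] y \<alpha> by simp
    then have "h y \<le> M2" using y x(2)[of y] unfolding M2_def by linarith
    ultimately show ?thesis using y m1[of y] m2[of y] by (auto simp: E_def \<Psi>_def mem_epigraph)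
  qed
  moreover have "(w, g w, h w) \<in> B \<times> {m1..M1} \<times> {m2..M2} \<inter> E"
    using w by (intro mem) (auto simp: v_def)
  ultimately obtain p where p: "p \<in> B \<times> {m1..M1} \<times> {m2..M2} \<inter> E"
    "\<And>p'. p' \<in> B \<times> {m1..M1} \<times> {m2..M2} \<inter> E \<Longrightarrow> \<Psi> p \<le> \<Psi> p'"
    using continuous_attains_inf[of _ \<Psi>] continuous_on_subset[OF \<Psi>]
    by (metis empty_iff subset_UNIV)
  obtain y a b where pe: "p = (y, a, b)" by (cases p) auto
  have y: "y \<in> B" "y \<in> S" "y \<in> R" "g y \<le> a" "h y \<le> b" "\<Psi> p \<le> v"
    using p(1) unfolding pe E_def by (auto simp: mem_epigraph)
  have "\<alpha> * g y + h y + q y \<le> \<Psi> p"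
    using y \<alpha> by (simp add: \<Psi>_def pe add_mono)
  moreover have "\<Psi> p \<le> \<alpha> * g z + h z + q z" if "z \<in> B" "z \<in> S" "z \<in> R" for z
  proof (cases "\<alpha> * g z + h z + q z \<le> v")
    case True
    then show ?thesis using p(2)[OF mem[OF that True]] by (simp add: \<Psi>_def)
  qed (use y in linarith)
  ultimately show ?thesis using y by (intro that[of y]) (auto intro: order_trans)
qed

lemma GDERIV_unique:
  fixes g :: "'a::euclidean_space \<Rightarrow> real"
  assumes "GDERIV g x :> v" "GDERIV g x :> w"
  shows "v = w"
proof -
  have "(\<lambda>h. h \<bullet> v) = (\<lambda>h. h \<bullet> w)"
    using assms has_derivative_unique unfolding gderiv_def by blast
  then show ?thesis by (metis vector_eq_ldot)
qed

lemma grad_eq: "GDERIV g x :> v \<Longrightarrow> grad g x = v"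
  for g :: "'a::euclidean_space \<Rightarrow> real"
  unfolding grad_def by (intro the_equality) (auto intro: GDERIV_unique)

lemma GDERIV_grad:
  fixes g :: "'a::euclidean_space \<Rightarrow> real"
  assumes "g differentiable at x"
  shows "GDERIV g x :> grad g x"
proof -
  obtain g' where g': "(g has_derivative g') (at x)"
    using assms by (auto simp: differentiable_def)
  then interpret linear g' using has_derivative_linear by blast
  have rep: "g' h = h \<bullet> (\<Sum>b\<in>Basis. g' b *\<^sub>R b)" for h
  proof -
    have "g' h = g' (\<Sum>b\<in>Basis. (h \<bullet> b) *\<^sub>R b)" by (simp add: euclidean_representation)
    also have "\<dots> = (\<Sum>b\<in>Basis. (h \<bullet> b) * g' b)" by (simp add: sum scale)
    finally show ?thesis by (simp add: inner_sum_right mult.commute)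
  qed
  have ex: "GDERIV g x :> (\<Sum>b\<in>Basis. g' b *\<^sub>R b)"
    using g' rep unfolding gderiv_def by (metis (no_types, lifting) ext)
  show ?thesis unfolding grad_def using ex GDERIV_unique by (metis theI)
qed

lemma GDERIV_directional:
  fixes g :: "'a::euclidean_space \<Rightarrow> real"
  assumes "GDERIV g x :> d"
  shows "((\<lambda>u. (g (x + u *\<^sub>R v) - g x) / u) \<longlongrightarrow> d \<bullet> v) (at 0)"
proof -
  have line: "((\<lambda>u. x + u *\<^sub>R v) has_derivative (\<lambda>u. u *\<^sub>R v)) (at 0)"
    by (auto intro!: derivative_eq_intros)
  have "(g has_derivative (\<lambda>h. h \<bullet> d)) (at (x + 0 *\<^sub>R v))"
    using assms by (simp add: gderiv_def)
  from has_derivative_compose[OF line this]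
  have "((\<lambda>u. g (x + u *\<^sub>R v)) has_real_derivative d \<bullet> v) (at 0)"
    unfolding has_field_derivative_def
    by (rule has_derivative_eq_rhs) (auto simp: inner_commute)
  then show ?thesis by (simp add: DERIV_def)
qed

section \<open>Strongly convex Legendre functions\<close>

locale legendre_kernel =
  fixes \<Phi> :: "'a::euclidean_space \<Rightarrow> ereal" and N :: "'a \<Rightarrow> real"
  assumes Phi_legendre: "legendre \<Phi>"
    and N_norm: "is_norm N"
    and Phi_strongly_convex: "strongly_convex_function 1 N \<Phi>"
begin

abbreviation C :: "'a set" where "C \<equiv> effective_domain \<Phi>"
abbreviation U :: "'a set" where "U \<equiv> interior C"
abbreviation \<phi> :: "'a \<Rightarrow> real" where "\<phi> \<equiv> \<lambda>x. real_of_ereal (\<Phi> x)"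

text \<open>The Bregman divergence computed in the reals; extended reals enter only through
  \<open>bregman_finite\<close> and \<open>bregman_infinite\<close>.\<close>

definition bdiv :: "'a \<Rightarrow> 'a \<Rightarrow> real" where
  "bdiv y x = \<phi> y - \<phi> x - egrad \<Phi> x \<bullet> (y - x)"

lemma U_subset_C: "x \<in> U \<Longrightarrow> x \<in> C"
  using interior_subset by blast

lemma Phi_finite: "y \<in> C \<Longrightarrow> \<Phi> y = ereal (\<phi> y)"
  using Phi_legendre unfolding legendre_def effective_domain_def by (cases "\<Phi> y") auto

lemma Phi_cases: "y \<in> C \<Longrightarrow> (\<And>p. \<Phi> y = ereal p \<Longrightarrow> thesis) \<Longrightarrow> thesis"
  using Phi_finite by blast

lemma Phi_infinite: "y \<notin> C \<Longrightarrow> \<Phi> y = \<infinity>"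
  unfolding effective_domain_def by auto

lemma phi_strongly_convex:
  assumes xy: "x \<in> C" "y \<in> C" and u: "0 \<le> u" "u \<le> 1"
  shows "(1 - u) *\<^sub>R x + u *\<^sub>R y \<in> C"
    and "\<phi> ((1 - u) *\<^sub>R x + u *\<^sub>R y) + u * (1 - u) / 2 * (N (y - x))\<^sup>2 \<le> (1 - u) * \<phi> x + u * \<phi> y"
proof -
  let ?z = "(1 - u) *\<^sub>R x + u *\<^sub>R y"
  have "\<Phi> ?z + ereal (1 / 2 * u * (1 - u) * (N (y - x))\<^sup>2) \<le> ereal (1 - u) * \<Phi> x + ereal u * \<Phi> y"
    using Phi_strongly_convex xy u unfolding strongly_convex_function_def by blast
  then have le: "\<Phi> ?z + ereal (1 / 2 * u * (1 - u) * (N (y - x))\<^sup>2) \<le> ereal ((1 - u) * \<phi> x + u * \<phi> y)"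
    by (cases rule: Phi_cases[OF xy(1)]; cases rule: Phi_cases[OF xy(2)]) simp
  then have "\<Phi> ?z < \<infinity>" by (cases "\<Phi> ?z") auto
  then show z: "?z \<in> C" by (simp add: effective_domain_def)
  show "\<phi> ?z + u * (1 - u) / 2 * (N (y - x))\<^sup>2 \<le> (1 - u) * \<phi> x + u * \<phi> y"
    using le by (cases rule: Phi_cases[OF z]) simp
qed

lemma convex_C: "convex C"
  unfolding convex_alt using phi_strongly_convex(1) by blast

lemma phi_convex: "convex_on C \<phi>"
proof (rule convex_onI[OF _ convex_C])
  fix t :: real and x y assume t: "0 < t" "t < 1" and xy: "x \<in> C" "y \<in> C"
  have "0 \<le> t * (1 - t) / 2 * (N (y - x))\<^sup>2" using t by simp
  then show "\<phi> ((1 - t) *\<^sub>R x + t *\<^sub>R y) \<le> (1 - t) * \<phi> x + t * \<phi> y"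
    using phi_strongly_convex(2)[OF xy, of t] t by linarith
qed

lemma phi_continuous: "continuous_on U \<phi>"
  by (intro convex_on_continuous convex_on_subset[OF phi_convex] interior_subset
      convex_interior convex_C open_interior)

lemma phi_GDERIV: "x \<in> U \<Longrightarrow> GDERIV \<phi> x :> egrad \<Phi> x"
  using Phi_legendre unfolding legendre_def by (intro GDERIV_grad) blast

text \<open>The strong convexity inequality at \<open>x + u (y - x)\<close>, divided by \<open>u\<close>, becomes this bound as
  \<open>u\<close> tends to \<open>0\<close>.\<close>

lemma bdiv_ge:
  assumes x: "x \<in> U" and y: "y \<in> C"
  shows "(N (y - x))\<^sup>2 / 2 \<le> bdiv y x"
proof -
  have lim: "((\<lambda>u. (\<phi> (x + u *\<^sub>R (y - x)) - \<phi> x) / u) \<longlongrightarrow> egrad \<Phi> x \<bullet> (y - x)) (at_right 0)"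
    using GDERIV_directional[OF phi_GDERIV[OF x]] by (rule tendsto_mono[OF at_le[OF subset_UNIV], rotated])
  have "((\<lambda>u. \<phi> y - \<phi> x - (1 - u) / 2 * (N (y - x))\<^sup>2)
      \<longlongrightarrow> \<phi> y - \<phi> x - (1 - 0) / 2 * (N (y - x))\<^sup>2) (at_right 0)"
    by (intro tendsto_intros) simp
  moreover have "\<forall>\<^sub>F u in at_right 0.
      (\<phi> (x + u *\<^sub>R (y - x)) - \<phi> x) / u \<le> \<phi> y - \<phi> x - (1 - u) / 2 * (N (y - x))\<^sup>2"
    using eventually_at_right_real[of 0 "1::real", simplified]
  proof eventually_elim
    case (elim u)
    then have u: "0 < u" "u \<le> 1" by auto
    have "x + u *\<^sub>R (y - x) = (1 - u) *\<^sub>R x + u *\<^sub>R y" by (simp add: algebra_simps)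
    then have "\<phi> (x + u *\<^sub>R (y - x)) + u * (1 - u) / 2 * (N (y - x))\<^sup>2 \<le> (1 - u) * \<phi> x + u * \<phi> y"
      using phi_strongly_convex(2)[OF U_subset_C[OF x] y, of u] u by simp
    then have "\<phi> (x + u *\<^sub>R (y - x)) - \<phi> x \<le> (\<phi> y - \<phi> x - (1 - u) / 2 * (N (y - x))\<^sup>2) * u"
      by (simp add: algebra_simps)
    then show ?case using u by (simp add: pos_divide_le_eq)
  qed
  ultimately have "egrad \<Phi> x \<bullet> (y - x) \<le> \<phi> y - \<phi> x - (1 - 0) / 2 * (N (y - x))\<^sup>2"
    using lim by (intro tendsto_le[where F = "at_right 0"]) auto
  then show ?thesis unfolding bdiv_def by simp
qed

lemma bdiv_nonneg: "x \<in> U \<Longrightarrow> y \<in> C \<Longrightarrow> 0 \<le> bdiv y x"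
  using bdiv_ge[of x y] by (smt (verit) zero_le_power2 divide_nonneg_pos)

lemma bregman_finite:
  assumes "x \<in> U" "y \<in> C"
  shows "bregman \<Phi> y x = ereal (bdiv y x)"
  unfolding bregman_def bdiv_def
  by (cases rule: Phi_cases[OF assms(2)]; cases rule: Phi_cases[OF U_subset_C[OF assms(1)]]) simp

lemma bregman_infinite:
  assumes "x \<in> U" "y \<notin> C"
  shows "bregman \<Phi> y x = \<infinity>"
  unfolding bregman_def
  by (cases rule: Phi_cases[OF U_subset_C[OF assms(1)]]) (simp add: Phi_infinite assms)

lemma segment_in_U:
  "y \<in> C \<Longrightarrow> z \<in> U \<Longrightarrow> 0 < t \<Longrightarrow> t \<le> 1 \<Longrightarrow> y + t *\<^sub>R (z - y) \<in> U"
  using mem_interior_convex_shrink[OF convex_C, of z y t] by (simp add: algebra_simps)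

text \<open>If the values along the segment from the
  boundary point \<open>y\<close> to the interior point \<open>z\<close> fell at most linearly near \<open>y\<close>, then the
  directional derivatives towards \<open>z\<close> would be bounded below. Together with an upper bound for
  \<open>\<phi>\<close> on a ball around \<open>z\<close>, the gradient inequality would bound the gradients on the segment.
  Convexity extends the strict inequality from one parameter \<open>s\<close> to all smaller ones.\<close>

lemma steep_at_boundary:
  assumes y: "y \<in> C" "y \<notin> U" and z: "z \<in> U"
  obtains s where "0 < s" "s \<le> 1"
    "\<And>t. 0 < t \<Longrightarrow> t \<le> s \<Longrightarrow> \<phi> (y + t *\<^sub>R (z - y)) < \<phi> y - c * t"
proof -
  define x where "x t = y + t *\<^sub>R (z - y)" for t :: real
  have xU: "x t \<in> U" if "0 < t" "t \<le> 1" for t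
    unfolding x_def using segment_in_U[OF y(1) z that] .
  have "\<exists>s. 0 < s \<and> s \<le> 1 \<and> \<phi> (x s) < \<phi> y - c * s"
  proof (rule ccontr)
    assume "\<not> ?thesis"
    then have ge: "\<phi> y - c * t \<le> \<phi> (x t)" if "0 < t" "t \<le> 1" for t
      using that by force
    obtain e where e: "0 < e" "cball z e \<subseteq> U"
      using z open_contains_cball[of U] by auto
    have "\<exists>m\<in>cball z e. \<forall>w\<in>cball z e. \<phi> w \<le> \<phi> m"
      using e by (intro continuous_attains_sup continuous_on_subset[OF phi_continuous]) auto
    then obtain K where K: "\<And>w. w \<in> cball z e \<Longrightarrow> \<phi> w \<le> K" by blast
    have bound: "norm (egrad \<Phi> (x t)) \<le> (K - \<phi> y + c) / e" if t: "0 < t" "t \<le> 1" for t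
    proof -
      define g where "g = egrad \<Phi> (x t)"
      \<comment> \<open>The point of the ball in the direction of the gradient makes the pairing see its full norm.\<close>
      define w where "w = z + (e / norm g) *\<^sub>R g"
      have w: "w \<in> cball z e" using e by (simp add: w_def dist_norm)
      then have "0 \<le> bdiv w (x t)" using e xU[OF t] U_subset_C by (intro bdiv_nonneg) auto
      then have 1: "g \<bullet> (w - x t) \<le> K - \<phi> (x t)"
        using K[OF w] unfolding bdiv_def g_def by linarith
      have "w - x t = (1 - t) *\<^sub>R (z - y) + (e / norm g) *\<^sub>R g"
        unfolding w_def x_def by (simp add: algebra_simps)
      moreover have "e / norm g * (g \<bullet> g) = e * norm g"
        by (cases "g = 0") (auto simp: power2_norm_eq_inner[symmetric] power2_eq_square)
      ultimately have 2: "g \<bullet> (w - x t) = (1 - t) * (g \<bullet> (z - y)) + e * norm g"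
        by (simp add: inner_add_right)
      have "0 \<le> bdiv y (x t)" using xU[OF t] y by (intro bdiv_nonneg) auto
      then have "- (t * (g \<bullet> (z - y))) \<le> \<phi> y - \<phi> (x t)"
        unfolding bdiv_def g_def[symmetric] by (simp add: x_def)
      then have "- (t * (g \<bullet> (z - y))) \<le> t * c" using ge[OF t] by (simp add: mult.commute)
      then have "t * (- (g \<bullet> (z - y))) \<le> t * c" by simp
      then have "- (g \<bullet> (z - y)) \<le> c" using t(1) by (rule mult_left_le_imp_le)
      then have "(1 - t) * (- (g \<bullet> (z - y))) \<le> (1 - t) * c"
        using t by (intro mult_left_mono) auto
      then have "norm g * e \<le> K - \<phi> y + c" using 1 2 ge[OF t] by (simp add: algebra_simps)
      then show ?thesis using e by (simp add: g_def pos_le_divide_eq)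
    qed
    define X where "X k = x (1 / real (Suc k))" for k
    have "(\<lambda>k. y + (1 / real (Suc k)) *\<^sub>R (z - y)) \<longlonglongrightarrow> y + 0 *\<^sub>R (z - y)"
      by (intro tendsto_intros LIMSEQ_Suc[OF lim_const_over_n])
    then have "X \<longlonglongrightarrow> y" unfolding X_def x_def by simp
    moreover have "\<forall>k. X k \<in> U" by (auto simp: X_def intro!: xU)
    moreover have "y \<in> frontier C"
      using y closure_subset by (auto simp: frontier_def)
    ultimately have "filterlim (\<lambda>k. norm (egrad \<Phi> (X k))) at_top sequentially"
      using Phi_legendre unfolding legendre_def by blast
    then have "\<forall>\<^sub>F k in sequentially. (K - \<phi> y + c) / e < norm (egrad \<Phi> (X k))"
      by (simp add: filterlim_at_top_dense)
    then obtain k where "(K - \<phi> y + c) / e < norm (egrad \<Phi> (X k))"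
      using eventually_happens by fastforce
    moreover have "norm (egrad \<Phi> (X k)) \<le> (K - \<phi> y + c) / e"
      unfolding X_def by (rule bound) auto
    ultimately show False by simp
  qed
  then obtain s where s: "0 < s" "s \<le> 1" "\<phi> (x s) < \<phi> y - c * s" by blast
  show ?thesis
  proof (rule that[OF s(1,2)])
    fix t assume t: "0 < t" "t \<le> s"
    have "x t = (1 - t / s) *\<^sub>R y + (t / s) *\<^sub>R x s"
      using s by (simp add: x_def algebra_simps)
    then have "\<phi> (x t) \<le> (1 - t / s) * \<phi> y + (t / s) * \<phi> (x s)"
      using convex_onD[OF phi_convex, of "t / s" y "x s"] t s y U_subset_C[OF xU] by simp
    also have "\<dots> < (1 - t / s) * \<phi> y + (t / s) * (\<phi> y - c * s)"
      using t s by (intro add_strict_left_mono mult_strict_left_mono) auto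
    also have "\<dots> = \<phi> y - c * t" using s by (simp add: field_simps)
    finally show "\<phi> (y + t *\<^sub>R (z - y)) < \<phi> y - c * t" unfolding x_def .
  qed
qed

lemma phi_measurable: "\<phi> \<in> borel_measurable (restrict_space borel U)"
  by (intro borel_measurable_continuous_on_restrict phi_continuous)

text \<open>Each component of the gradient is a limit of difference quotients. Their evaluation points may
  leave \<open>U\<close>, so \<open>\<phi>\<close> is first extended by \<open>0\<close>; for points of \<open>U\<close> the limit only sees values
  inside the open set \<open>U\<close>.\<close>

lemma egrad_measurable: "egrad \<Phi> \<in> borel_measurable (restrict_space borel U)"
proof (rule iffD2[OF borel_measurable_euclidean_space], rule ballI)
  fix b :: 'a
  define \<psi> where "\<psi> x = indicator U x *\<^sub>R \<phi> x" for x
  have \<psi>: "\<psi> \<in> borel_measurable borel"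
    unfolding \<psi>_def
    by (intro borel_measurable_continuous_on_indicator[OF _ phi_continuous]) auto
  define e where "e n = 1 / real (Suc n)" for n
  have e: "e \<longlonglongrightarrow> 0" "\<And>n. e n \<noteq> 0"
    unfolding e_def using LIMSEQ_Suc[OF lim_const_over_n[of "1::real"]] by simp_all
  show "(\<lambda>x. egrad \<Phi> x \<bullet> b) \<in> borel_measurable (restrict_space borel U)"
  proof (rule borel_measurable_LIMSEQ_real)
    fix x assume "x \<in> space (restrict_space borel U)"
    then have x: "x \<in> U" by simp
    have "filterlim e (at 0) sequentially"
      unfolding filterlim_at using e by simp
    then have lim: "(\<lambda>n. (\<phi> (x + e n *\<^sub>R b) - \<phi> x) / e n) \<longlonglongrightarrow> egrad \<Phi> x \<bullet> b"
      by (rule filterlim_compose[OF GDERIV_directional[OF phi_GDERIV[OF x]]])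
    have "(\<lambda>n. x + e n *\<^sub>R b) \<longlonglongrightarrow> x + 0 *\<^sub>R b"
      by (intro tendsto_intros e)
    then have "\<forall>\<^sub>F n in sequentially. x + e n *\<^sub>R b \<in> U"
      using x by (intro topological_tendstoD[where l = x]) auto
    then have "\<forall>\<^sub>F n in sequentially.
        (\<phi> (x + e n *\<^sub>R b) - \<phi> x) / e n = (\<psi> (x + e n *\<^sub>R b) - \<psi> x) / e n"
      by eventually_elim (simp add: \<psi>_def x)
    then show "(\<lambda>n. (\<psi> (x + e n *\<^sub>R b) - \<psi> x) / e n) \<longlonglongrightarrow> egrad \<Phi> x \<bullet> b"
      by (rule Lim_transform_eventually[OF lim])
  next
    fix n
    have "(\<lambda>x. (\<psi> (x + e n *\<^sub>R b) - \<psi> x) / e n) \<in> borel_measurable borel"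
      using \<psi> by measurable
    then show "(\<lambda>x. (\<psi> (x + e n *\<^sub>R b) - \<psi> x) / e n) \<in> borel_measurable (restrict_space borel U)"
      by (rule measurable_restrict_space1)
  qed
qed

end

section \<open>Proximal subproblems\<close>

locale regularized = legendre_kernel +
  fixes r :: "'a \<Rightarrow> ereal" and \<rho> :: real and x0 :: 'a
  assumes r_not_minus_inf: "\<And>x. r x \<noteq> -\<infinity>"
    and r_closed: "closed_function r"
    and r_dom_convex: "convex (effective_domain r)"
    and rho_nonneg: "0 \<le> \<rho>"
    and r_weakly_convex: "weakly_convex_relative \<rho> r \<Phi>"
    and x0_feasible: "x0 \<in> interior (effective_domain \<Phi>) \<inter> effective_domain r"
begin

abbreviation R :: "'a set" where "R \<equiv> effective_domain r"
abbreviation r' :: "'a \<Rightarrow> real" where "r' \<equiv> \<lambda>x. real_of_ereal (r x)"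
abbreviation A :: "'a set" where "A \<equiv> U \<inter> R"

lemma A_subset: "x \<in> A \<Longrightarrow> x \<in> C \<inter> R"
  using U_subset_C by auto

lemma r_finite: "y \<in> R \<Longrightarrow> r y = ereal (r' y)"
  using r_not_minus_inf[of y] unfolding effective_domain_def by (cases "r y") auto

lemma r_cases: "y \<in> R \<Longrightarrow> (\<And>b. r y = ereal b \<Longrightarrow> thesis) \<Longrightarrow> thesis"
  using r_finite by blast

lemma r_infinite: "y \<notin> R \<Longrightarrow> r y = \<infinity>"
  unfolding effective_domain_def by auto

lemma convex_CR: "convex (C \<inter> R)"
  by (intro convex_Int convex_C r_dom_convex)

lemma segment_in_CR:
  "x \<in> C \<inter> R \<Longrightarrow> y \<in> C \<inter> R \<Longrightarrow> 0 \<le> t \<Longrightarrow> t \<le> 1 \<Longrightarrow> x + t *\<^sub>R (y - x) \<in> C \<inter> R"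
  using convexD_alt[OF convex_CR, of x y t] by (simp add: algebra_simps)

text \<open>The convex function that relative weak convexity of \<open>r\<close> provides.\<close>

definition p :: "'a \<Rightarrow> real" where "p y = r' y + \<rho> * \<phi> y"

lemma p_convex: "convex_on (C \<inter> R) p"
proof (rule convex_onI[OF _ convex_CR])
  let ?g = "\<lambda>x. r x + ereal \<rho> * \<Phi> x"
  have eq: "?g y = ereal (p y)" if "y \<in> C \<inter> R" for y
    by (cases rule: Phi_cases[OF IntD1[OF that]]; cases rule: r_cases[OF IntD2[OF that]])
      (simp add: p_def)
  fix t :: real and x y assume t: "0 < t" "t < 1" and xy: "x \<in> C \<inter> R" "y \<in> C \<inter> R"
  let ?z = "(1 - t) *\<^sub>R x + t *\<^sub>R y"
  have z: "?z \<in> C \<inter> R" using convexD_alt[OF convex_CR xy, of t] t by simp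
  have "convex_on (effective_domain ?g) (\<lambda>x. real_of_ereal (?g x))"
    using r_weakly_convex unfolding weakly_convex_relative_def convex_function_def .
  moreover have "x \<in> effective_domain ?g" "y \<in> effective_domain ?g"
    unfolding effective_domain_def mem_Collect_eq eq[OF xy(1)] eq[OF xy(2)] by simp_all
  ultimately have "real_of_ereal (?g ?z) \<le> (1 - t) * real_of_ereal (?g x) + t * real_of_ereal (?g y)"
    using t by (intro convex_onD) auto
  then show "p ?z \<le> (1 - t) * p x + t * p y"
    unfolding eq[OF xy(1)] eq[OF xy(2)] eq[OF z] by simp
qed

lemma p_segment:
  assumes "x \<in> C \<inter> R" "y \<in> C \<inter> R" "0 \<le> t" "t \<le> 1"
  shows "p (x + t *\<^sub>R (y - x)) \<le> p x + t * (p y - p x)"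
  using convex_onD[OF p_convex assms(3,4,1,2)] by (simp add: algebra_simps)

text \<open>On the unit ball around \<open>x0\<close> the closed functions \<open>\<phi>\<close> and \<open>r\<close> are bounded below. Farther out,
  convexity on the ray from \<open>x0\<close> bounds the value at \<open>y\<close> in terms of the value where the ray leaves
  that ball.\<close>

lemma p_minorant:
  obtains a b where "\<And>y. y \<in> C \<inter> R \<Longrightarrow> - a - b * norm (y - x0) \<le> p y"
proof -
  have x0: "x0 \<in> C \<inter> R" using x0_feasible A_subset by blast
  obtain m1 where m1: "\<And>y. y \<in> cball x0 1 \<Longrightarrow> y \<in> C \<Longrightarrow> m1 \<le> \<phi> y"
    using closed_epigraph_bounded_below[of C \<phi> "cball x0 1"] Phi_legendre
    unfolding legendre_def closed_function_def by auto
  obtain m2 where m2: "\<And>y. y \<in> cball x0 1 \<Longrightarrow> y \<in> R \<Longrightarrow> m2 \<le> r' y"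
    using closed_epigraph_bounded_below[of R r' "cball x0 1"] r_closed
    unfolding closed_function_def by auto
  define m where "m = m2 + \<rho> * m1"
  have m: "m \<le> p y" if "y \<in> C \<inter> R" "norm (y - x0) \<le> 1" for y
    unfolding m_def p_def
    using that m1[of y] m2[of y] rho_nonneg
    by (intro add_mono mult_left_mono) (auto simp: dist_norm norm_minus_commute)
  have "- (\<bar>m\<bar> + \<bar>p x0\<bar>) - \<bar>p x0 - m\<bar> * norm (y - x0) \<le> p y" if y: "y \<in> C \<inter> R" for y
  proof (cases "norm (y - x0) \<le> 1")
    case True
    have "0 \<le> \<bar>p x0 - m\<bar> * norm (y - x0)" by simp
    then show ?thesis using m[OF y True] by linarith
  next
    case False
    define n where "n = norm (y - x0)"
    have n: "1 < n" using False by (simp add: n_def)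
    then have u: "0 \<le> 1 / n" "1 / n \<le> 1" by simp_all
    have "norm ((1 / n) *\<^sub>R (y - x0)) \<le> 1" using n by (simp add: n_def)
    then have "m \<le> p (x0 + (1 / n) *\<^sub>R (y - x0))"
      using u y x0 by (intro m segment_in_CR) simp_all
    also have "\<dots> \<le> p x0 + (1 / n) * (p y - p x0)"
      by (intro p_segment x0 y u)
    finally have "m - p x0 \<le> (p y - p x0) / n" by simp
    then have "n * (m - p x0) \<le> p y - p x0" using n by (simp add: pos_le_divide_eq mult.commute)
    moreover have "n * (- \<bar>p x0 - m\<bar>) \<le> n * (m - p x0)"
      using n by (intro mult_left_mono) auto
    ultimately show ?thesis unfolding n_def[symmetric] by (simp add: mult.commute)
  qed
  then show ?thesis by (rule that)
qed

end

text \<open>After expansion of the divergence, the proximal problem and the mirror step both minimize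
  \<open>\<alpha> \<Phi> + r + q - \<langle>c, \<cdot>\<rangle>\<close>: the former with \<open>q = f\<close> and \<open>\<alpha> = 1 / lam\<close>, the latter with \<open>q = 0\<close>
  and \<open>\<alpha> = 1 / \<eta>\<close>. The vector \<open>c\<close> collects the gradient of \<open>\<Phi>\<close> at the current point and the
  stochastic gradient. The lower bound \<open>q_minorant\<close> makes the model coercive: the part
  \<open>(\<alpha> - \<beta>) \<Phi>\<close> that is left grows quadratically. It comes from \<open>min F\<close> (with \<open>\<beta> = 0\<close>) in the
  first case and from convexity of \<open>r + \<rho> \<Phi>\<close> (with \<open>\<beta> = \<rho>\<close>) in the second.\<close>

locale prox_model = regularized +
  fixes q :: "'a \<Rightarrow> real" and \<tau> \<alpha> :: real
  assumes q_lipschitz: "locally_lipschitz q"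
    and q_diff: "\<And>x. x \<in> A \<Longrightarrow> q differentiable at x"
    and q_lower: "\<And>x y. x \<in> A \<Longrightarrow> y \<in> A \<Longrightarrow> q x + grad q x \<bullet> (y - x) - \<tau> * bdiv y x \<le> q y"
    and q_minorant: "\<exists>\<beta><\<alpha>. \<exists>a b. \<forall>y\<in>C \<inter> R. - a - b * norm (y - x0) \<le> r' y + \<beta> * \<phi> y + q y"
    and tau_nonneg: "0 \<le> \<tau>"
    and alpha_large: "\<rho> + \<tau> < \<alpha>"
begin

definition model :: "'a \<Rightarrow> 'a \<Rightarrow> real" where
  "model c y = \<alpha> * \<phi> y + r' y + (q y - c \<bullet> y)"

lemma alpha_pos: "0 < \<alpha>"
  using alpha_large rho_nonneg tau_nonneg by linarith

lemma q_continuous: "continuous_on UNIV q"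
proof (rule continuous_at_imp_continuous_on, rule ballI)
  fix x
  obtain \<delta> L where "0 < \<delta>" "L-lipschitz_on (ball x \<delta>) q"
    using q_lipschitz unfolding locally_lipschitz_def by blast
  then show "isCont q x"
    using lipschitz_on_continuous_on continuous_on_interior
    by (metis centre_in_ball interior_ball)
qed

lemma model_coercive:
  obtains \<kappa> where "\<And>y. y \<in> C \<inter> R \<Longrightarrow> \<kappa> < norm (y - x0) \<Longrightarrow> model c x0 < model c y"
proof -
  obtain \<beta> a b where \<beta>: "\<beta> < \<alpha>"
    and ab: "\<And>y. y \<in> C \<inter> R \<Longrightarrow> - a - b * norm (y - x0) \<le> r' y + \<beta> * \<phi> y + q y"
    using q_minorant by blast
  obtain k where k: "0 < k" "\<And>x. k * norm x \<le> N x"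
    using is_norm_bounds_norm[OF N_norm] by blast
  define g where "g = egrad \<Phi> x0"
  define d where "d = (\<alpha> - \<beta>) * (k\<^sup>2 / 2)"
  have d: "0 < d" using \<beta> k by (simp add: d_def)
  define e where "e = (\<alpha> - \<beta>) * \<phi> x0 - a - c \<bullet> x0"
  define L where "L = b + (\<alpha> - \<beta>) * norm g + norm c"
  define D where "D = \<bar>model c x0 - e\<bar>"
  show ?thesis
  proof (rule that)
    \<comment> \<open>Beyond this radius the quadratic term dominates the linear one with slope L and the constant D.\<close>
    fix y assume y: "y \<in> C \<inter> R" and far: "max 1 ((\<bar>L\<bar> + D) / d) < norm (y - x0)"
    define n where "n = norm (y - x0)"
    have n: "1 < n" "\<bar>L\<bar> + D < d * n"
      using far d by (auto simp: n_def pos_divide_less_eq mult.commute)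
    have "(k * n)\<^sup>2 \<le> (N (y - x0))\<^sup>2"
      using k n unfolding n_def by (intro power_mono) auto
    then have "\<phi> x0 + g \<bullet> (y - x0) + k\<^sup>2 / 2 * n\<^sup>2 \<le> \<phi> y"
      using bdiv_ge[of x0 y] x0_feasible y unfolding bdiv_def g_def by (simp add: power_mult_distrib)
    moreover have "- (norm g * n) \<le> g \<bullet> (y - x0)"
      unfolding n_def using Cauchy_Schwarz_ineq2[of g "y - x0"] by linarith
    ultimately have "\<phi> x0 - norm g * n + k\<^sup>2 / 2 * n\<^sup>2 \<le> \<phi> y" by linarith
    then have "(\<alpha> - \<beta>) * (\<phi> x0 - norm g * n + k\<^sup>2 / 2 * n\<^sup>2) \<le> (\<alpha> - \<beta>) * \<phi> y"
      using \<beta> by (intro mult_left_mono) auto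
    moreover have "c \<bullet> y \<le> c \<bullet> x0 + norm c * n"
      unfolding n_def using norm_cauchy_schwarz[of c "y - x0"] by (simp add: inner_diff_right)
    moreover have "- a - b * n \<le> r' y + \<beta> * \<phi> y + q y" unfolding n_def by (rule ab[OF y])
    ultimately have "e - L * n + d * n\<^sup>2 \<le> model c y"
      unfolding e_def L_def d_def model_def by (simp add: algebra_simps)
    moreover have "n * (\<bar>L\<bar> + D) < n * (d * n)" using n by (intro mult_strict_left_mono) auto
    then have "\<bar>L\<bar> * n + D * n < d * n\<^sup>2" by (simp add: algebra_simps power2_eq_square)
    moreover have "D * 1 \<le> D * n" using n by (intro mult_left_mono) (auto simp: D_def)
    moreover have "L * n \<le> \<bar>L\<bar> * n" using n by (intro mult_right_mono) auto
    moreover have "model c x0 \<le> e + D" by (simp add: D_def)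
    ultimately show "model c x0 < model c y" by linarith
  qed
qed

lemma model_attains_min:
  obtains y where "y \<in> C \<inter> R" "\<And>z. z \<in> C \<inter> R \<Longrightarrow> model c y \<le> model c z"
proof -
  have x0: "x0 \<in> C \<inter> R" using x0_feasible A_subset by blast
  obtain \<kappa> where \<kappa>: "\<And>y. y \<in> C \<inter> R \<Longrightarrow> \<kappa> < norm (y - x0) \<Longrightarrow> model c x0 < model c y"
    using model_coercive by blast
  let ?B = "cball x0 (max 0 \<kappa>)"
  have cl: "closed (epigraph C \<phi>)" "closed (epigraph R r')"
    using Phi_legendre r_closed unfolding legendre_def closed_function_def by auto
  have cont: "continuous_on UNIV (\<lambda>y. q y - c \<bullet> y)"
    by (intro continuous_intros q_continuous)
  have B: "compact ?B" "x0 \<in> ?B" "x0 \<in> C" "x0 \<in> R" using x0 by auto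
  obtain y where y: "y \<in> ?B" "y \<in> C" "y \<in> R"
    "\<And>z. z \<in> ?B \<Longrightarrow> z \<in> C \<Longrightarrow> z \<in> R \<Longrightarrow> model c y \<le> model c z"
    unfolding model_def by (rule sum_attains_min_on_compact[OF cl cont alpha_pos B]) blast
  show ?thesis
  proof (rule that)
    fix z assume z: "z \<in> C \<inter> R"
    show "model c y \<le> model c z"
    proof (cases "z \<in> ?B")
      case False
      then have "model c x0 < model c z" using \<kappa>[OF z] by (auto simp: dist_norm norm_minus_commute)
      moreover have "model c y \<le> model c x0" using x0 by (intro y) auto
      ultimately show ?thesis by linarith
    qed (use y z in auto)
  qed (use y in auto)
qed

lemma model_alt: "model c y = (\<alpha> - \<rho>) * \<phi> y + p y + q y - c \<bullet> y"
  unfolding model_def p_def by (simp add: algebra_simps)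

text \<open>Moving from a boundary point \<open>y\<close> of \<open>C\<close> towards \<open>x0\<close>, the term \<open>(\<alpha> - \<rho>) \<phi>\<close> falls faster than
  any linear rate, while \<open>p\<close> grows at most linearly by convexity and \<open>q\<close> by its Lipschitz bound.
  Hence \<open>y\<close> is not a minimizer.\<close>

lemma minimizer_in_U:
  assumes y: "y \<in> C \<inter> R" and min: "\<And>z. z \<in> C \<inter> R \<Longrightarrow> model c y \<le> model c z"
  shows "y \<in> U"
proof (rule ccontr)
  assume "y \<notin> U"
  have x0: "x0 \<in> C \<inter> R" "x0 \<in> U" using x0_feasible A_subset by auto
  obtain \<delta> L where \<delta>: "0 < \<delta>" and L: "L-lipschitz_on (ball y \<delta>) q"
    using q_lipschitz unfolding locally_lipschitz_def by blast
  \<comment> \<open>The rate at which the other terms of the model can grow, relative to the coefficient of \<open>\<phi>\<close>.\<close>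
  define \<gamma> where "\<gamma> = (p x0 - p y + L * norm (x0 - y) - c \<bullet> (x0 - y)) / (\<alpha> - \<rho>)"
  have \<alpha>\<rho>: "0 < \<alpha> - \<rho>" using alpha_large tau_nonneg by linarith
  obtain s where s: "0 < s" "s \<le> 1"
    "\<And>t. 0 < t \<Longrightarrow> t \<le> s \<Longrightarrow> \<phi> (y + t *\<^sub>R (x0 - y)) < \<phi> y - \<gamma> * t"
    using steep_at_boundary[of y x0 \<gamma>] y \<open>y \<notin> U\<close> x0 by auto
  \<comment> \<open>A parameter for which the point also stays in the ball on which \<open>q\<close> is Lipschitz.\<close>
  define t where "t = min s (\<delta> / (2 * (norm (x0 - y) + 1)))"
  have t: "0 < t" "t \<le> s" "t \<le> 1" using s \<delta> by (auto simp: t_def intro!: divide_pos_pos add_nonneg_pos)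
  define z where "z = y + t *\<^sub>R (x0 - y)"
  have z: "z \<in> C \<inter> R" unfolding z_def using t by (intro segment_in_CR y x0) auto
  have "t * norm (x0 - y) \<le> \<delta> / (2 * (norm (x0 - y) + 1)) * norm (x0 - y)"
    by (intro mult_right_mono) (auto simp: t_def)
  also have "\<dots> < \<delta>"
  proof -
    have "n < 2 * (n + 1)" "0 < 2 * (n + 1)" if "0 \<le> n" for n :: real using that by simp_all
    from this[OF norm_ge_zero[of "x0 - y"]] show ?thesis
      using mult_strict_left_mono[OF _ \<delta>] by (simp add: pos_divide_less_eq)
  qed
  finally have "z \<in> ball y \<delta>" using t by (simp add: z_def dist_norm)
  then have "dist (q z) (q y) \<le> L * dist z y" using L \<delta> by (intro lipschitz_onD) auto
  moreover have "dist z y = t * norm (x0 - y)" using t by (simp add: z_def dist_norm)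
  ultimately have "\<bar>q z - q y\<bar> \<le> t * (L * norm (x0 - y))"
    by (simp add: dist_real_def mult.left_commute)
  then have qz: "q z - q y \<le> t * (L * norm (x0 - y))" by simp
  have "(\<alpha> - \<rho>) * \<phi> z < (\<alpha> - \<rho>) * (\<phi> y - \<gamma> * t)"
    unfolding z_def using s(3)[OF t(1,2)] \<alpha>\<rho> by (rule mult_strict_left_mono)
  also have "\<dots> = (\<alpha> - \<rho>) * \<phi> y - t * ((\<alpha> - \<rho>) * \<gamma>)" by (simp add: algebra_simps)
  also have "(\<alpha> - \<rho>) * \<gamma> = p x0 - p y + L * norm (x0 - y) - c \<bullet> (x0 - y)"
    using \<alpha>\<rho> by (simp add: \<gamma>_def)
  finally have "(\<alpha> - \<rho>) * \<phi> z
      < (\<alpha> - \<rho>) * \<phi> y - t * (p x0 - p y) - t * (L * norm (x0 - y)) + t * (c \<bullet> (x0 - y))"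
    by (simp add: algebra_simps)
  moreover have "p z \<le> p y + t * (p x0 - p y)"
    unfolding z_def using t by (intro p_segment y x0) auto
  moreover have "c \<bullet> z = c \<bullet> y + t * (c \<bullet> (x0 - y))" by (simp add: z_def inner_add_right)
  ultimately have "model c z < model c y" unfolding model_alt using qz by linarith
  then show False using min[OF z] by linarith
qed

text \<open>The difference quotients of the model at \<open>y\<close> towards \<open>z\<close> are nonnegative. In them, \<open>p\<close> is replaced
  by its chord, which is what convexity offers, and \<open>\<phi>\<close> and \<open>q\<close> pass to their gradients. The
  limit is a first-order condition that compares \<open>p z\<close> with \<open>p y\<close>; adding the lower bound for
  \<open>q\<close> leaves \<open>(\<alpha> - \<rho>)\<close> divergences from \<open>\<phi>\<close> minus \<open>\<tau>\<close> divergences from \<open>q\<close>.\<close>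

lemma minimizer_growth:
  assumes y: "y \<in> A" and min: "\<And>z. z \<in> C \<inter> R \<Longrightarrow> model c y \<le> model c z" and z: "z \<in> A"
  shows "model c y + (\<alpha> - \<rho> - \<tau>) * bdiv z y \<le> model c z"
proof -
  define d where "d = z - y"
  have yz: "y \<in> C \<inter> R" "z \<in> C \<inter> R" using y z A_subset by auto
  have le: "at_right 0 \<le> at (0::real)" by (rule at_le) simp
  have "((\<lambda>u. (\<phi> (y + u *\<^sub>R d) - \<phi> y) / u) \<longlongrightarrow> egrad \<Phi> y \<bullet> d) (at_right 0)"
    using y by (intro tendsto_mono[OF le GDERIV_directional] phi_GDERIV) auto
  moreover have "((\<lambda>u. (q (y + u *\<^sub>R d) - q y) / u) \<longlongrightarrow> grad q y \<bullet> d) (at_right 0)"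
    using y by (intro tendsto_mono[OF le GDERIV_directional] GDERIV_grad q_diff) auto
  ultimately have lim: "((\<lambda>u. (\<alpha> - \<rho>) * ((\<phi> (y + u *\<^sub>R d) - \<phi> y) / u) + (q (y + u *\<^sub>R d) - q y) / u
      + (p z - p y - c \<bullet> d)) \<longlongrightarrow>
      (\<alpha> - \<rho>) * (egrad \<Phi> y \<bullet> d) + grad q y \<bullet> d + (p z - p y - c \<bullet> d)) (at_right 0)"
    by (intro tendsto_intros)
  have "\<forall>\<^sub>F u in at_right 0. 0 \<le> (\<alpha> - \<rho>) * ((\<phi> (y + u *\<^sub>R d) - \<phi> y) / u)
      + (q (y + u *\<^sub>R d) - q y) / u + (p z - p y - c \<bullet> d)"
    using eventually_at_right_real[of 0 "1::real", simplified]
  proof eventually_elim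
    case (elim u)
    then have u: "0 < u" "u \<le> 1" by auto
    have "model c y \<le> model c (y + u *\<^sub>R d)"
      unfolding d_def using u by (intro min segment_in_CR yz) auto
    moreover have "p (y + u *\<^sub>R d) \<le> p y + u * (p z - p y)"
      unfolding d_def using u by (intro p_segment yz) auto
    ultimately have "0 \<le> (\<alpha> - \<rho>) * (\<phi> (y + u *\<^sub>R d) - \<phi> y) + (q (y + u *\<^sub>R d) - q y)
        + u * (p z - p y - c \<bullet> d)"
      unfolding model_alt by (simp add: inner_add_right algebra_simps)
    then have "0 \<le> ((\<alpha> - \<rho>) * (\<phi> (y + u *\<^sub>R d) - \<phi> y) + (q (y + u *\<^sub>R d) - q y)
        + u * (p z - p y - c \<bullet> d)) / u"
      using u by simp
    then show ?case using u by (simp add: add_divide_distrib)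
  qed
  then have "0 \<le> (\<alpha> - \<rho>) * (egrad \<Phi> y \<bullet> d) + grad q y \<bullet> d + (p z - p y - c \<bullet> d)"
    by (rule tendsto_lowerbound[OF lim]) simp
  moreover have "q y + grad q y \<bullet> d - \<tau> * bdiv z y \<le> q z"
    unfolding d_def by (rule q_lower[OF y z])
  ultimately show ?thesis
    unfolding model_alt bdiv_def d_def by (simp add: inner_diff_right algebra_simps)
qed

definition sol :: "'a \<Rightarrow> 'a" where
  "sol c = (SOME y. y \<in> C \<inter> R \<and> (\<forall>z\<in>C \<inter> R. model c y \<le> model c z))"

lemma sol_minimizes:
  shows sol_in_A: "sol c \<in> A"
    and sol_min: "z \<in> C \<inter> R \<Longrightarrow> model c (sol c) \<le> model c z"
proof -
  have "\<exists>y. y \<in> C \<inter> R \<and> (\<forall>z\<in>C \<inter> R. model c y \<le> model c z)"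
    using model_attains_min[of c] by metis
  from someI_ex[OF this]
  have *: "sol c \<in> C \<inter> R" "\<And>z. z \<in> C \<inter> R \<Longrightarrow> model c (sol c) \<le> model c z"
    unfolding sol_def by auto
  show "sol c \<in> A" using *(1) minimizer_in_U[OF *] by auto
  show "z \<in> C \<inter> R \<Longrightarrow> model c (sol c) \<le> model c z" by (rule *(2))
qed

lemma sol_growth: "z \<in> A \<Longrightarrow> model c (sol c) + (\<alpha> - \<rho> - \<tau>) * bdiv z (sol c) \<le> model c z"
  by (intro minimizer_growth sol_minimizes)

lemma sol_unique:
  assumes y: "y \<in> C \<inter> R" and min: "\<And>z. z \<in> C \<inter> R \<Longrightarrow> model c y \<le> model c z"
  shows "y = sol c"
proof -
  have A: "y \<in> A" using y minimizer_in_U[OF y min] by simp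
  have "model c y \<le> model c (sol c)" using sol_in_A A_subset by (intro min) blast
  with sol_growth[OF A, of c] have "(\<alpha> - \<rho> - \<tau>) * bdiv y (sol c) \<le> (\<alpha> - \<rho> - \<tau>) * 0" by simp
  then have "bdiv y (sol c) \<le> 0" by (rule mult_left_le_imp_le) (use alpha_large in simp)
  then have "(N (y - sol c))\<^sup>2 / 2 \<le> 0"
    using bdiv_ge[of "sol c" y] sol_in_A[of c] y by (meson IntD1 order_trans)
  then have "N (y - sol c) = 0" by simp
  then show ?thesis using is_normD(3)[OF N_norm, of "y - sol c"] by force
qed

text \<open>The growth inequalities for \<open>c\<close> and \<open>c'\<close>, each tested at the other minimizer, add up to a bound
  of the symmetrized divergence, and so of the squared distance, by the pairing of \<open>c - c'\<close> with the
  difference of the minimizers.\<close>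

lemma sol_lipschitz:
  obtains L where "\<And>c c'. norm (sol c - sol c') \<le> L * norm (c - c')"
proof -
  obtain k where k: "0 < k" "\<And>x. k * norm x \<le> N x"
    using is_norm_bounds_norm[OF N_norm] by blast
  define \<mu> where "\<mu> = \<alpha> - \<rho> - \<tau>"
  have \<mu>: "0 < \<mu>" using alpha_large by (simp add: \<mu>_def)
  have half: "k\<^sup>2 / 2 * (norm (sol c - sol c'))\<^sup>2 \<le> bdiv (sol c) (sol c')" for c c'
  proof -
    have "(k * norm (sol c - sol c'))\<^sup>2 \<le> (N (sol c - sol c'))\<^sup>2"
      using k by (intro power_mono) auto
    then show ?thesis
      using bdiv_ge[of "sol c'" "sol c"] sol_in_A[of c] sol_in_A[of c'] U_subset_C
      by (auto simp: power_mult_distrib)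
  qed
  have "norm (sol c - sol c') \<le> 1 / (\<mu> * k\<^sup>2) * norm (c - c')" for c c'
  proof (cases "sol c = sol c'")
    case False
    define n where "n = norm (sol c - sol c')"
    have n: "0 < n" using False by (simp add: n_def)
    have "model c (sol c) + \<mu> * bdiv (sol c') (sol c) \<le> model c (sol c')"
      unfolding \<mu>_def by (intro sol_growth sol_in_A)
    moreover have "model c' (sol c') + \<mu> * bdiv (sol c) (sol c') \<le> model c' (sol c)"
      unfolding \<mu>_def by (intro sol_growth sol_in_A)
    ultimately have "\<mu> * (bdiv (sol c') (sol c) + bdiv (sol c) (sol c')) \<le> (c - c') \<bullet> (sol c - sol c')"
      unfolding model_def by (simp add: algebra_simps)
    also have "\<dots> \<le> norm (c - c') * n"
      unfolding n_def by (rule norm_cauchy_schwarz)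
    finally have 1: "\<mu> * (bdiv (sol c') (sol c) + bdiv (sol c) (sol c')) \<le> norm (c - c') * n" .
    have "k\<^sup>2 * n\<^sup>2 \<le> bdiv (sol c') (sol c) + bdiv (sol c) (sol c')"
      using half[of c c'] half[of c' c] unfolding n_def by (simp add: norm_minus_commute)
    then have "\<mu> * (k\<^sup>2 * n\<^sup>2) \<le> norm (c - c') * n"
      using 1 \<mu> by (meson mult_left_mono less_imp_le order_trans)
    then have "(\<mu> * k\<^sup>2 * n) * n \<le> norm (c - c') * n" by (simp add: power2_eq_square mult_ac)
    then have "\<mu> * k\<^sup>2 * n \<le> norm (c - c')" using n by (rule mult_right_le_imp_le)
    then show ?thesis using \<mu> k unfolding n_def[symmetric] by (simp add: field_simps)
  qed (use \<mu> in simp)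
  then show ?thesis by (rule that)
qed

lemma sol_measurable: "sol \<in> borel_measurable borel"
proof -
  obtain L where L: "\<And>c c'. norm (sol c - sol c') \<le> L * norm (c - c')"
    using sol_lipschitz by blast
  have "\<bar>L\<bar>-lipschitz_on UNIV sol"
  proof (rule lipschitz_onI)
    fix c c' :: 'a
    have "L * norm (c - c') \<le> \<bar>L\<bar> * norm (c - c')" by (intro mult_right_mono) auto
    then show "dist (sol c) (sol c') \<le> \<bar>L\<bar> * dist c c'" using L[of c c'] by (simp add: dist_norm)
  qed simp
  then show ?thesis by (intro borel_measurable_continuous_onI lipschitz_on_continuous_on)
qed

text \<open>A minimum of functions that are affine in \<open>c\<close> is concave, hence continuous.\<close>

lemma min_value_measurable: "(\<lambda>c. model c (sol c)) \<in> borel_measurable borel"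
proof -
  have "convex_on UNIV (\<lambda>c. - model c (sol c))"
  proof (rule convex_onI)
    fix t :: real and c c' :: 'a
    assume t: "0 < t" "t < 1"
    define z where "z = sol ((1 - t) *\<^sub>R c + t *\<^sub>R c')"
    have z: "z \<in> C \<inter> R" unfolding z_def using sol_in_A A_subset by blast
    have "model ((1 - t) *\<^sub>R c + t *\<^sub>R c') z = (1 - t) * model c z + t * model c' z"
      unfolding model_def by (simp add: algebra_simps)
    moreover have "(1 - t) * model c (sol c) \<le> (1 - t) * model c z"
      using t sol_min[OF z] by (intro mult_left_mono) auto
    moreover have "t * model c' (sol c') \<le> t * model c' z"
      using t sol_min[OF z] by (intro mult_left_mono) auto
    ultimately show "- model ((1 - t) *\<^sub>R c + t *\<^sub>R c') (sol ((1 - t) *\<^sub>R c + t *\<^sub>R c'))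
        \<le> (1 - t) * - model c (sol c) + t * - model c' (sol c')"
      unfolding z_def[symmetric] by simp
  qed auto
  then have "(\<lambda>c. - (- model c (sol c))) \<in> borel_measurable borel"
    by (intro borel_measurable_uminus borel_measurable_continuous_onI convex_on_continuous) auto
  then show ?thesis by simp
qed

lemma subproblem_eq_model:
  assumes x: "x \<in> U"
  shows "ereal (q y + v \<bullet> y) + r y + ereal \<alpha> * bregman \<Phi> y x =
    (if y \<in> C \<inter> R
     then ereal (model (\<alpha> *\<^sub>R egrad \<Phi> x - v) y + \<alpha> * (egrad \<Phi> x \<bullet> x - \<phi> x)) else \<infinity>)"
proof (cases "y \<in> C \<inter> R")
  case True
  obtain b where b: "r y = ereal b" using r_cases[OF IntD2[OF True]] by metis
  have "ereal (q y + v \<bullet> y) + r y + ereal \<alpha> * bregman \<Phi> y x = ereal (q y + v \<bullet> y + b + \<alpha> * bdiv y x)"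
    using bregman_finite[OF x, of y] True by (simp add: b)
  also have "q y + v \<bullet> y + b + \<alpha> * bdiv y x =
      model (\<alpha> *\<^sub>R egrad \<Phi> x - v) y + \<alpha> * (egrad \<Phi> x \<bullet> x - \<phi> x)"
    unfolding model_def bdiv_def b by (simp add: algebra_simps)
  finally show ?thesis using True by simp
next
  case False
  show ?thesis
  proof (cases "y \<in> C")
    case True
    then show ?thesis using False bregman_finite[OF x True] r_infinite[of y] by auto
  next
    case notC: False
    have inf: "ereal \<alpha> * bregman \<Phi> y x = \<infinity>"
      using alpha_pos by (simp add: bregman_infinite[OF x notC])
    show ?thesis unfolding inf using notC r_not_minus_inf[of y] by simp
  qed
qed

lemma arg_min_subproblem:
  assumes x: "x \<in> U"
  shows "arg_min (\<lambda>y. ereal (q y + v \<bullet> y) + r y + ereal \<alpha> * bregman \<Phi> y x) (\<lambda>_. True) =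
    sol (\<alpha> *\<^sub>R egrad \<Phi> x - v)"
proof -
  define H where "H y = ereal (q y + v \<bullet> y) + r y + ereal \<alpha> * bregman \<Phi> y x" for y
  define c where "c = \<alpha> *\<^sub>R egrad \<Phi> x - v"
  define e where "e = \<alpha> * (egrad \<Phi> x \<bullet> x - \<phi> x)"
  have H: "H y = (if y \<in> C \<inter> R then ereal (model c y + e) else \<infinity>)" for y
    unfolding H_def c_def e_def by (rule subproblem_eq_model[OF x])
  have s: "sol c \<in> C \<inter> R" using sol_in_A A_subset by blast
  have "H (sol c) \<le> H y" for y using s sol_min[of y c] by (simp add: H)
  then have "is_arg_min H (\<lambda>_. True) (sol c)" by (auto simp: is_arg_min_def not_less)
  then have "is_arg_min H (\<lambda>_. True) (arg_min H (\<lambda>_. True))"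
    unfolding arg_min_def by (rule someI)
  then have le: "H (arg_min H (\<lambda>_. True)) \<le> H y" for y by (auto simp: is_arg_min_def not_less)
  have K: "arg_min H (\<lambda>_. True) \<in> C \<inter> R" using le[of "sol c"] s by (auto simp: H split: if_splits)
  have "arg_min H (\<lambda>_. True) = sol c"
  proof (rule sol_unique[OF K])
    fix z assume "z \<in> C \<inter> R"
    then show "model c (arg_min H (\<lambda>_. True)) \<le> model c z" using le[of z] K by (simp add: H)
  qed
  then show ?thesis unfolding H_def c_def .
qed

end

section \<open>One step of mirror descent\<close>

locale composite_problem = regularized +
  fixes f :: "'a \<Rightarrow> real" and \<tau> M lam :: real and xmin :: 'a
  assumes f_lipschitz: "locally_lipschitz f"
    and f_diff: "\<And>x. x \<in> A \<Longrightarrow> f differentiable at x"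
    and tau_nonneg: "0 \<le> \<tau>" and M_nonneg: "0 \<le> M"
    and f_relative_bounds: "\<And>x y. x \<in> A \<Longrightarrow> y \<in> A \<Longrightarrow>
          ereal (- \<tau>) * bregman \<Phi> y x \<le> ereal (f y - f x - grad f x \<bullet> (y - x)) \<and>
          ereal (f y - f x - grad f x \<bullet> (y - x)) \<le> ereal M * bregman \<Phi> y x"
    and lam_pos: "0 < lam" and lam_small: "lam * (\<tau> + \<rho>) < 1"
    and xmin: "is_arg_min (objective f r) (\<lambda>_. True) xmin"
begin

abbreviation Fmin :: real where "Fmin \<equiv> real_of_ereal (objective f r xmin)"

lemma objective_finite: "y \<in> R \<Longrightarrow> objective f r y = ereal (f y + r' y)"
  unfolding objective_def by (cases rule: r_cases) auto

lemma Fmin_le: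
  assumes y: "y \<in> R"
  shows "Fmin \<le> f y + r' y"
proof -
  have le: "objective f r xmin \<le> ereal (f y + r' y)"
    using xmin objective_finite[OF y] unfolding is_arg_min_def by (metis not_less)
  then have "xmin \<in> R" unfolding objective_def effective_domain_def by (cases "r xmin") auto
  then show ?thesis using le objective_finite[of xmin] by simp
qed

lemma f_lower: "x \<in> A \<Longrightarrow> y \<in> A \<Longrightarrow> f x + grad f x \<bullet> (y - x) - \<tau> * bdiv y x \<le> f y"
  and f_upper: "x \<in> A \<Longrightarrow> y \<in> A \<Longrightarrow> f y \<le> f x + grad f x \<bullet> (y - x) + M * bdiv y x"
  using f_relative_bounds[of x y] bregman_finite[of x y] U_subset_C by auto

lemma inverse_lam_large: "\<rho> + \<tau> < 1 / lam"
  using lam_pos lam_small by (simp add: pos_less_divide_eq algebra_simps)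

sublocale prx: prox_model \<Phi> N r \<rho> x0 f \<tau> "1 / lam"
proof unfold_locales
  show "\<exists>\<beta><1 / lam. \<exists>a b. \<forall>y\<in>C \<inter> R. - a - b * norm (y - x0) \<le> r' y + \<beta> * \<phi> y + f y"
    using Fmin_le lam_pos
    by (intro exI[of _ 0] conjI exI[of _ "- Fmin"]) (auto simp: add.commute)
qed (use f_lipschitz f_diff f_lower tau_nonneg inverse_lam_large in auto)

abbreviation prox :: "'a \<Rightarrow> 'a" where "prox x \<equiv> bregman_prox \<Phi> lam (objective f r) x"

definition env :: "'a \<Rightarrow> real" where "env x = real_of_ereal (bregman_envelope \<Phi> lam (objective f r) x)"

text \<open>The proximal problem is the instance with zero stochastic gradient.\<close>

lemma envelope_objective:
  "objective f r y + ereal (1 / lam) * bregman \<Phi> y x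
    = ereal (f y + 0 \<bullet> y) + r y + ereal (1 / lam) * bregman \<Phi> y x"
  by (simp add: objective_def)

lemma prox_eq_sol: "x \<in> U \<Longrightarrow> prox x = prx.sol ((1 / lam) *\<^sub>R egrad \<Phi> x)"
  unfolding bregman_prox_def envelope_objective prx.arg_min_subproblem by simp

lemma prox_in_A: "x \<in> U \<Longrightarrow> prox x \<in> A"
  using prx.sol_in_A prox_eq_sol by simp

lemma env_eq_min_value:
  assumes x: "x \<in> U"
  shows "env x = prx.model ((1 / lam) *\<^sub>R egrad \<Phi> x) (prx.sol ((1 / lam) *\<^sub>R egrad \<Phi> x))
      + 1 / lam * (egrad \<Phi> x \<bullet> x - \<phi> x)"
proof -
  define c where "c = (1 / lam) *\<^sub>R egrad \<Phi> x"
  define e where "e = 1 / lam * (egrad \<Phi> x \<bullet> x - \<phi> x)"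
  have H: "objective f r y + ereal (1 / lam) * bregman \<Phi> y x =
      (if y \<in> C \<inter> R then ereal (prx.model c y + e) else \<infinity>)" for y
    unfolding envelope_objective prx.subproblem_eq_model[OF x] c_def e_def by simp
  have s: "prx.sol c \<in> C \<inter> R" using prx.sol_in_A A_subset by blast
  have "bregman_envelope \<Phi> lam (objective f r) x = ereal (prx.model c (prx.sol c) + e)"
    unfolding bregman_envelope_def
  proof (rule antisym)
    show "(INF y. objective f r y + ereal (1 / lam) * bregman \<Phi> y x) \<le> ereal (prx.model c (prx.sol c) + e)"
      by (rule INF_lower2[of "prx.sol c"]) (use s in \<open>auto simp: H\<close>)
    show "ereal (prx.model c (prx.sol c) + e) \<le> (INF y. objective f r y + ereal (1 / lam) * bregman \<Phi> y x)"
      by (rule INF_greatest) (auto simp: H intro: prx.sol_min)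
  qed
  then show ?thesis by (simp add: env_def c_def e_def)
qed

lemma env_le:
  assumes x: "x \<in> U" and y: "y \<in> C \<inter> R"
  shows "env x \<le> f y + r' y + 1 / lam * bdiv y x"
proof -
  define c where "c = (1 / lam) *\<^sub>R egrad \<Phi> x"
  have "env x \<le> prx.model c y + 1 / lam * (egrad \<Phi> x \<bullet> x - \<phi> x)"
    unfolding env_eq_min_value[OF x] c_def using prx.sol_min[OF y] by simp
  also have "\<dots> = f y + r' y + 1 / lam * bdiv y x"
    unfolding prx.model_def bdiv_def c_def by (simp add: algebra_simps)
  finally show ?thesis .
qed

lemma env_eq_prox:
  assumes x: "x \<in> U"
  shows "env x = f (prox x) + r' (prox x) + 1 / lam * bdiv (prox x) x"
  unfolding env_eq_min_value[OF x] prox_eq_sol[OF x, symmetric] prx.model_def bdiv_def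
  by (simp add: algebra_simps)

lemma Fmin_le_env: "x \<in> U \<Longrightarrow> Fmin \<le> env x"
  using env_eq_prox[of x] Fmin_le[of "prox x"] prox_in_A[of x] bdiv_nonneg[of x "prox x"] lam_pos U_subset_C
  by (smt (verit) IntD1 IntD2 mult_nonneg_nonneg divide_nonneg_pos)

lemma id_measurable: "(\<lambda>x. x) \<in> borel_measurable (restrict_space borel U)"
  by (intro measurable_restrict_space1 measurable_ident_sets refl)

lemma env_measurable: "env \<in> borel_measurable (restrict_space borel U)"
proof -
  have "(\<lambda>x. (1 / lam) *\<^sub>R egrad \<Phi> x) \<in> borel_measurable (restrict_space borel U)"
    by (intro borel_measurable_scaleR borel_measurable_const egrad_measurable)
  note borel_measurable_add[OF measurable_compose[OF this prx.min_value_measurable]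
    borel_measurable_times[OF borel_measurable_const[where c = "1 / lam"] borel_measurable_diff[OF
        borel_measurable_inner[OF egrad_measurable id_measurable] phi_measurable]]]
  then show ?thesis
    by (rule measurable_cong[THEN iffD2, rotated]) (simp add: env_eq_min_value)
qed

lemma prox_measurable: "prox \<in> borel_measurable (restrict_space borel U)"
proof -
  have "(\<lambda>x. (1 / lam) *\<^sub>R egrad \<Phi> x) \<in> borel_measurable (restrict_space borel U)"
    by (intro borel_measurable_scaleR borel_measurable_const egrad_measurable)
  from measurable_compose[OF this prx.sol_measurable] show ?thesis
    by (rule measurable_cong[THEN iffD2, rotated]) (simp add: prox_eq_sol)
qed

lemma bdiv_prox_measurable: "(\<lambda>x. bdiv (prox x) x) \<in> borel_measurable (restrict_space borel U)"
proof -
  have prox: "prox \<in> measurable (restrict_space borel U) (restrict_space borel U)"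
    using prox_in_A by (intro measurable_restrict_space2 prox_measurable) auto
  show ?thesis
    unfolding bdiv_def
    by (intro borel_measurable_diff measurable_compose[OF prox phi_measurable] phi_measurable
        borel_measurable_inner egrad_measurable prox_measurable id_measurable)
qed

end

locale smd_step = composite_problem +
  fixes \<eta> :: real
  assumes eta_pos: "0 < \<eta>" and eta_small: "\<eta> < lam / (1 + lam * M)"
begin

lemma inverse_eta_large: "M + 1 / lam < 1 / \<eta>"
proof -
  have "0 < 1 + lam * M" using lam_pos M_nonneg by (simp add: add_pos_nonneg)
  then have "\<eta> * (1 + lam * M) < lam" using eta_small by (simp add: pos_less_divide_eq)
  then have "(1 + lam * M) / lam < 1 / \<eta>" using lam_pos eta_pos by (simp add: field_simps)
  also have "(1 + lam * M) / lam = M + 1 / lam" using lam_pos by (simp add: field_simps)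
  finally show ?thesis .
qed

lemma rho_less_inverse_eta: "\<rho> < 1 / \<eta>"
  using inverse_eta_large inverse_lam_large tau_nonneg M_nonneg by linarith

sublocale st: prox_model \<Phi> N r \<rho> x0 "\<lambda>_. 0" 0 "1 / \<eta>"
proof unfold_locales
  show "locally_lipschitz (\<lambda>_::'a. 0::real)"
    unfolding locally_lipschitz_def
  proof
    fix x :: 'a
    have "0-lipschitz_on (ball x 1) (\<lambda>_::'a. 0::real)" by (rule lipschitz_onI) auto
    then show "\<exists>\<delta>>0. \<exists>L. L-lipschitz_on (ball x \<delta>) (\<lambda>_::'a. 0::real)"
      using zero_less_one by blast
  qed
  have "grad (\<lambda>_. 0) x = 0" for x :: 'a by (intro grad_eq GDERIV_const)
  then show "0 + grad (\<lambda>_. 0) x \<bullet> (y - x) - 0 * bdiv y x \<le> 0" for x y by simp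
  obtain a b where "\<And>y. y \<in> C \<inter> R \<Longrightarrow> - a - b * norm (y - x0) \<le> p y"
    using p_minorant by blast
  then show "\<exists>\<beta><1 / \<eta>. \<exists>a b. \<forall>y\<in>C \<inter> R. - a - b * norm (y - x0) \<le> r' y + \<beta> * \<phi> y + 0"
    using rho_less_inverse_eta unfolding p_def by (intro exI[of _ \<rho>] conjI exI[of _ a] exI[of _ b]) auto
qed (use rho_less_inverse_eta in auto)

definition step :: "'a \<Rightarrow> 'a \<Rightarrow> 'a" where
  "step x v = st.sol ((1 / \<eta>) *\<^sub>R egrad \<Phi> x - v)"

lemma arg_min_step:
  "x \<in> U \<Longrightarrow>
    arg_min (\<lambda>y. ereal (v \<bullet> y) + r y + ereal (1 / \<eta>) * bregman \<Phi> y x) (\<lambda>_. True) = step x v"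
  unfolding step_def using st.arg_min_subproblem[of x v] by simp

lemma step_in_A: "step x v \<in> A"
  unfolding step_def by (rule st.sol_in_A)

lemma step_growth:
  assumes z: "z \<in> A"
  shows "v \<bullet> step x v + r' (step x v) + 1 / \<eta> * bdiv (step x v) x + (1 / \<eta> - \<rho>) * bdiv z (step x v)
    \<le> v \<bullet> z + r' z + 1 / \<eta> * bdiv z x"
  using st.sol_growth[OF z, of "(1 / \<eta>) *\<^sub>R egrad \<Phi> x - v"]
  unfolding step_def[symmetric] st.model_def bdiv_def by (simp add: algebra_simps)

text \<open>The coefficient of \<open>D(y, x)\<close> that is left to absorb the noise: \<open>1 / \<eta>\<close> from the step, less \<open>M\<close>
  for relative smoothness and \<open>1 / lam\<close> for minimality of the proximal point.\<close>

definition noise_gap :: real where "noise_gap = 1 / \<eta> - M - 1 / lam"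

lemma noise_gap_pos: "0 < noise_gap"
  unfolding noise_gap_def using inverse_eta_large by linarith

text \<open>With \<open>z\<close> the proximal point and \<open>y\<close> the next iterate, this combines growth of the step's
  subproblem, both relative bounds for \<open>f\<close> and minimality of \<open>z\<close>. The remaining pairing of the noise
  with \<open>y - x\<close> is split by Young's inequality with parameter \<open>noise_gap\<close>, and strong convexity
  turns the squared norm of \<open>y - x\<close> into a divergence.\<close>

lemma step_descent:
  fixes v :: 'a
  assumes x: "x \<in> A"
  shows "(1 / \<eta> - \<rho>) * bdiv (prox x) (step x v) \<le> (1 / \<eta> + \<tau> - 1 / lam) * bdiv (prox x) x
    + (grad f x - v) \<bullet> (x - prox x) + (dual_norm N (v - grad f x))\<^sup>2 / (2 * noise_gap)"
proof -
  define y where "y = step x v"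
  define z where "z = prox x"
  have y: "y \<in> A" "y \<in> C \<inter> R" unfolding y_def using step_in_A A_subset by auto
  have z: "z \<in> A" unfolding z_def using x by (intro prox_in_A) auto
  have prox_min: "f z + r' z + 1 / lam * bdiv z x \<le> f y + r' y + 1 / lam * bdiv y x"
    using env_le[of x y] env_eq_prox[of x] x y unfolding z_def by auto
  have "f y \<le> f x + grad f x \<bullet> (y - x) + M * bdiv y x" by (rule f_upper[OF x y(1)])
  moreover have "f x + grad f x \<bullet> (z - x) - \<tau> * bdiv z x \<le> f z" by (rule f_lower[OF x z])
  moreover have "v \<bullet> y + r' y + 1 / \<eta> * bdiv y x + (1 / \<eta> - \<rho>) * bdiv z y
      \<le> v \<bullet> z + r' z + 1 / \<eta> * bdiv z x"
    unfolding y_def by (rule step_growth[OF z])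
  ultimately have main: "(1 / \<eta> - \<rho>) * bdiv z y \<le> (1 / \<eta> + \<tau> - 1 / lam) * bdiv z x
      + (grad f x - v) \<bullet> (x - z) + ((grad f x - v) \<bullet> (y - x) - noise_gap * bdiv y x)"
    using prox_min unfolding noise_gap_def by (simp add: algebra_simps)
  have "(grad f x - v) \<bullet> (y - x) = (v - grad f x) \<bullet> (x - y)" by (simp add: algebra_simps)
  also have "\<dots> \<le> dual_norm N (v - grad f x) * N (x - y)"
    by (rule inner_le_dual_norm[OF N_norm])
  also have "N (x - y) = N (y - x)" using is_normD(4)[OF N_norm, of "-1" "y - x"] by simp
  also have "dual_norm N (v - grad f x) * N (y - x)
      \<le> (dual_norm N (v - grad f x))\<^sup>2 / (2 * noise_gap) + noise_gap * ((N (y - x))\<^sup>2 / 2)"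
  proof -
    define a b where "a = dual_norm N (v - grad f x)" and "b = N (y - x)"
    have "0 \<le> (a - noise_gap * b)\<^sup>2 / (2 * noise_gap)" using noise_gap_pos by simp
    also have "\<dots> = a\<^sup>2 / (2 * noise_gap) + noise_gap * (b\<^sup>2 / 2) - a * b"
      using noise_gap_pos by (simp add: field_simps power2_eq_square)
    finally show ?thesis unfolding a_def b_def by linarith
  qed
  also have "noise_gap * ((N (y - x))\<^sup>2 / 2) \<le> noise_gap * bdiv y x"
    using noise_gap_pos x y by (intro mult_left_mono bdiv_ge) auto
  finally show ?thesis using main unfolding y_def z_def by linarith
qed

definition weight :: real where "weight = \<eta> / (1 - \<eta> * \<rho>)"

lemma weight_eq: "weight = 1 / (1 / \<eta> - \<rho>)"
  unfolding weight_def using eta_pos by (simp add: field_simps)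

lemma weight_pos: "0 < weight"
  unfolding weight_eq using rho_less_inverse_eta by simp

text \<open>The factor \<open>1 / \<eta> - \<rho>\<close> on the left of \<open>step_descent\<close> is the inverse of \<open>weight\<close>, and
  \<open>1 / \<eta> + \<tau> - 1 / lam\<close> equals that factor minus \<open>1 / lam - \<tau> - \<rho>\<close>; the proximal point of \<open>x\<close>
  is then used as a candidate for the envelope at the next iterate.\<close>

lemma envelope_descent:
  fixes v :: 'a
  assumes x: "x \<in> A"
  shows "env (step x v) \<le> env x - 1 / lam * (1 / lam - \<tau> - \<rho>) * weight * bdiv (prox x) x
    + weight / lam * ((grad f x - v) \<bullet> (x - prox x) + (dual_norm N (v - grad f x))\<^sup>2 / (2 * noise_gap))"
proof -
  define B where "B = bdiv (prox x) x"
  define E where "E = (grad f x - v) \<bullet> (x - prox x) + (dual_norm N (v - grad f x))\<^sup>2 / (2 * noise_gap)"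
  have w: "weight * (1 / \<eta> - \<rho>) = 1" unfolding weight_eq using rho_less_inverse_eta by simp
  have "weight * ((1 / \<eta> - \<rho>) * bdiv (prox x) (step x v)) \<le> weight * ((1 / \<eta> + \<tau> - 1 / lam) * B + E)"
    using step_descent[OF x, of v] weight_pos unfolding B_def E_def
    by (intro mult_left_mono) (auto simp: algebra_simps)
  also have "weight * ((1 / \<eta> - \<rho>) * bdiv (prox x) (step x v)) = bdiv (prox x) (step x v)"
    using w by (simp add: mult.assoc[symmetric])
  also have "weight * ((1 / \<eta> + \<tau> - 1 / lam) * B + E)
      = weight * (1 / \<eta> - \<rho>) * B - (1 / lam - \<tau> - \<rho>) * weight * B + weight * E"
    by (simp add: algebra_simps)
  finally have "bdiv (prox x) (step x v) \<le> B - (1 / lam - \<tau> - \<rho>) * weight * B + weight * E"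
    unfolding w by simp
  then have "1 / lam * bdiv (prox x) (step x v)
      \<le> 1 / lam * (B - (1 / lam - \<tau> - \<rho>) * weight * B + weight * E)"
    using lam_pos by (intro mult_left_mono) auto
  moreover have "env (step x v) \<le> f (prox x) + r' (prox x) + 1 / lam * bdiv (prox x) (step x v)"
    using x step_in_A prox_in_A A_subset by (intro env_le) blast+
  moreover have "env x = f (prox x) + r' (prox x) + 1 / lam * B"
    unfolding B_def using x by (intro env_eq_prox) auto
  moreover have "1 / lam * (B - (1 / lam - \<tau> - \<rho>) * weight * B + weight * E)
      = 1 / lam * B - 1 / lam * (1 / lam - \<tau> - \<rho>) * weight * B + weight / lam * E"
    using lam_pos by (simp add: field_simps)
  ultimately show ?thesis unfolding B_def[symmetric] E_def[symmetric] by linarith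
qed

text \<open>The pathwise bound is integrated over the fresh sample: the linear noise term vanishes by
  unbiasedness and the quadratic one is controlled by the variance. The loss is kept on the left
  so that both sides are sums of nonnegative terms.\<close>

lemma expected_envelope_descent:
  fixes Y :: "'w \<Rightarrow> 'a"
  assumes P: "prob_space P" and x: "x \<in> A" and unbiased: "has_bochner_integral P Y (grad f x)"
    and variance: "(\<integral>\<^sup>+ w. ennreal ((dual_norm N (Y w - grad f x))\<^sup>2) \<partial>P) \<le> ennreal (\<sigma>\<^sup>2 / 2)"
  shows "(\<integral>\<^sup>+ w. ennreal (env (step x (Y w)) - Fmin) \<partial>P)
      + ennreal (1 / lam * (1 / lam - \<tau> - \<rho>) * weight * bdiv (prox x) x)
    \<le> ennreal (env x - Fmin) + ennreal (weight / lam * (\<sigma>\<^sup>2 / (4 * noise_gap)))"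
proof -
  interpret prob_space P by (rule P)
  define d where "d w = (dual_norm N (Y w - grad f x))\<^sup>2" for w
  define K where "K = 1 / lam * (1 / lam - \<tau> - \<rho>) * weight * bdiv (prox x) x"
  \<comment> \<open>An integrable majorant of the gap after the step; it is nonnegative because the gap is.\<close>
  define Z where "Z w = env x - Fmin - K
      + weight / lam * ((grad f x - Y w) \<bullet> (x - prox x) + d w / (2 * noise_gap))" for w
  have K: "0 \<le> K"
    unfolding K_def using lam_pos inverse_lam_large weight_pos x prox_in_A[of x] U_subset_C
    by (intro mult_nonneg_nonneg bdiv_nonneg) auto
  have Y: "integrable P Y" "integral\<^sup>L P Y = grad f x"
    using unbiased by (auto simp: has_bochner_integral_iff)
  have d_meas: "d \<in> borel_measurable P"
    unfolding d_def
    using measurable_compose[OF _ dual_norm_measurable[OF N_norm]] borel_measurable_integrable[OF Y(1)]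
    by measurable
  have d_int: "integrable P d"
  proof (rule integrableI_nonneg[OF d_meas])
    show "(\<integral>\<^sup>+ w. ennreal (d w) \<partial>P) < \<infinity>"
      using variance unfolding d_def by (rule le_less_trans) simp
  qed (simp add: d_def)
  have "ennreal (integral\<^sup>L P d) = (\<integral>\<^sup>+ w. ennreal (d w) \<partial>P)"
    by (rule nn_integral_eq_integral[symmetric, OF d_int]) (simp add: d_def)
  also have "\<dots> \<le> ennreal (\<sigma>\<^sup>2 / 2)" using variance unfolding d_def .
  finally have d_le: "integral\<^sup>L P d \<le> \<sigma>\<^sup>2 / 2" by simp
  have Z_ge: "env (step x (Y w)) - Fmin \<le> Z w" for w
    using envelope_descent[OF x, of "Y w"] unfolding Z_def K_def d_def by linarith
  have Z_nonneg: "0 \<le> Z w" for w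
    using Z_ge[of w] Fmin_le_env[of "step x (Y w)"] step_in_A[of x "Y w"] by simp
  have Z_int: "integrable P Z"
    unfolding Z_def using Y(1) d_int by simp
  have "integral\<^sup>L P Z = env x - Fmin - K + weight / lam * (integral\<^sup>L P d / (2 * noise_gap))"
    unfolding Z_def using Y d_int by (simp add: prob_space)
  also have "\<dots> \<le> env x - Fmin - K + weight / lam * (\<sigma>\<^sup>2 / 2 / (2 * noise_gap))"
    using d_le noise_gap_pos weight_pos lam_pos
    by (intro add_left_mono mult_left_mono divide_right_mono) auto
  finally have Z_le: "integral\<^sup>L P Z + K \<le> (env x - Fmin) + weight / lam * (\<sigma>\<^sup>2 / (4 * noise_gap))"
    by simp
  have "(\<integral>\<^sup>+ w. ennreal (env (step x (Y w)) - Fmin) \<partial>P) \<le> (\<integral>\<^sup>+ w. ennreal (Z w) \<partial>P)"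
    by (intro nn_integral_mono ennreal_leI Z_ge)
  also have "\<dots> = ennreal (integral\<^sup>L P Z)"
    by (rule nn_integral_eq_integral[OF Z_int]) (simp add: Z_nonneg)
  finally have "(\<integral>\<^sup>+ w. ennreal (env (step x (Y w)) - Fmin) \<partial>P) + ennreal K
      \<le> ennreal (integral\<^sup>L P Z) + ennreal K"
    by (rule add_right_mono)
  also have "\<dots> = ennreal (integral\<^sup>L P Z + K)"
    using K Z_nonneg by (intro ennreal_plus[symmetric] integral_nonneg_AE) auto
  also have "\<dots> \<le> ennreal ((env x - Fmin) + weight / lam * (\<sigma>\<^sup>2 / (4 * noise_gap)))"
    by (rule ennreal_leI[OF Z_le])
  also have "\<dots> = ennreal (env x - Fmin) + ennreal (weight / lam * (\<sigma>\<^sup>2 / (4 * noise_gap)))"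
    using x Fmin_le_env[of x] weight_pos lam_pos noise_gap_pos by (intro ennreal_plus) auto
  finally show ?thesis unfolding K_def .
qed

end

section \<open>The stochastic process\<close>

text \<open>Tonelli's theorem for two random variables whose joint distribution is a product, with both
  integrals pulled back to the underlying probability space. The value types may differ, unlike in
  \<open>indep_var\<close>, where they coincide.\<close>

lemma (in prob_space) nn_integral_joint_product:
  assumes X: "X \<in> measurable M M1" and Y: "Y \<in> measurable M M2"
    and eq: "distr M M1 X \<Otimes>\<^sub>M distr M M2 Y = distr M (M1 \<Otimes>\<^sub>M M2) (\<lambda>x. (X x, Y x))"
    and h: "h \<in> borel_measurable (M1 \<Otimes>\<^sub>M M2)"
  shows "(\<integral>\<^sup>+ \<omega>. h (X \<omega>, Y \<omega>) \<partial>M) = (\<integral>\<^sup>+ \<omega>. (\<integral>\<^sup>+ \<omega>'. h (X \<omega>, Y \<omega>') \<partial>M) \<partial>M)"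
proof -
  interpret Y: prob_space "distr M M2 Y" by (rule prob_space_distr[OF Y])
  have sets_eq: "sets (distr M M1 X \<Otimes>\<^sub>M distr M M2 Y) = sets (M1 \<Otimes>\<^sub>M M2)"
    by (intro sets_pair_measure_cong) auto
  have h': "h \<in> borel_measurable (distr M M1 X \<Otimes>\<^sub>M distr M M2 Y)"
    using h by (simp add: measurable_cong_sets[OF sets_eq refl])
  have "(\<integral>\<^sup>+ \<omega>. h (X \<omega>, Y \<omega>) \<partial>M) = integral\<^sup>N (distr M M1 X \<Otimes>\<^sub>M distr M M2 Y) h"
    unfolding eq by (rule nn_integral_distr[symmetric]) (use X Y h in auto)
  also have "\<dots> = (\<integral>\<^sup>+ x. (\<integral>\<^sup>+ y. h (x, y) \<partial>distr M M2 Y) \<partial>distr M M1 X)"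
    by (rule Y.nn_integral_fst[OF h', symmetric])
  also have "\<dots> = (\<integral>\<^sup>+ \<omega>. (\<integral>\<^sup>+ y. h (X \<omega>, y) \<partial>distr M M2 Y) \<partial>M)"
    using Y.borel_measurable_nn_integral_fst[OF h'] by (intro nn_integral_distr X) simp
  also have "\<dots> = (\<integral>\<^sup>+ \<omega>. (\<integral>\<^sup>+ \<omega>'. h (X \<omega>, Y \<omega>') \<partial>M) \<partial>M)"
  proof (rule nn_integral_cong)
    fix \<omega> assume "\<omega> \<in> space M"
    then have "X \<omega> \<in> space M1" by (rule measurable_space[OF X])
    then have "(\<lambda>y. h (X \<omega>, y)) \<in> borel_measurable M2"
      by (intro measurable_compose[OF measurable_Pair1' h])
    then show "(\<integral>\<^sup>+ y. h (X \<omega>, y) \<partial>distr M M2 Y) = (\<integral>\<^sup>+ \<omega>'. h (X \<omega>, Y \<omega>') \<partial>M)"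
      by (intro nn_integral_distr Y) simp
  qed
  finally show ?thesis .
qed

lemma (in prob_space) distr_pair_of_indep_set:
  assumes X: "X \<in> measurable M M1" and Y: "Y \<in> measurable M M2"
    and indep: "indep_set (sets (vimage_algebra (space M) X M1)) (sets (vimage_algebra (space M) Y M2))"
  shows "distr M M1 X \<Otimes>\<^sub>M distr M M2 Y = distr M (M1 \<Otimes>\<^sub>M M2) (\<lambda>x. (X x, Y x))"
proof (rule pair_measure_eqI)
  interpret X: prob_space "distr M M1 X" by (rule prob_space_distr[OF X])
  interpret Y: prob_space "distr M M2 Y" by (rule prob_space_distr[OF Y])
  show "sigma_finite_measure (distr M M1 X)" "sigma_finite_measure (distr M M2 Y)"
    by unfold_locales
  show "sets (distr M M1 X \<Otimes>\<^sub>M distr M M2 Y) = sets (distr M (M1 \<Otimes>\<^sub>M M2) (\<lambda>x. (X x, Y x)))"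
    unfolding sets_distr by (intro sets_pair_measure_cong) auto
  fix A B assume "A \<in> sets (distr M M1 X)" "B \<in> sets (distr M M2 Y)"
  then have A: "A \<in> sets M1" and B: "B \<in> sets M2" by simp_all
  have "X -` A \<inter> space M \<in> sets (vimage_algebra (space M) X M1)"
    "Y -` B \<inter> space M \<in> sets (vimage_algebra (space M) Y M2)"
    using A B by (auto intro: in_vimage_algebra)
  then have "prob ((X -` A \<inter> space M) \<inter> (Y -` B \<inter> space M))
      = prob (X -` A \<inter> space M) * prob (Y -` B \<inter> space M)"
    using indep unfolding indep_sets2_eq by blast
  moreover have "(X -` A \<inter> space M) \<inter> (Y -` B \<inter> space M) = (\<lambda>x. (X x, Y x)) -` (A \<times> B) \<inter> space M"
    by auto
  ultimately show "emeasure (distr M M1 X) A * emeasure (distr M M2 Y) B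
      = emeasure (distr M (M1 \<Otimes>\<^sub>M M2) (\<lambda>x. (X x, Y x))) (A \<times> B)"
    using X Y A B
    by (simp add: emeasure_distr measurable_Pair emeasure_eq_measure ennreal_mult)
qed

locale smd_process = composite_problem +
  fixes P :: "'b measure" and G :: "'a \<Rightarrow> 'b \<Rightarrow> 'a" and S :: "'c measure"
    and \<xi> :: "nat \<Rightarrow> 'c \<Rightarrow> 'b" and \<eta> :: "nat \<Rightarrow> real" and \<sigma> :: real and T :: nat
  assumes P_prob: "prob_space P" and S_prob: "prob_space S"
    and xi_indep: "prob_space.indep_vars S (\<lambda>_. P) \<xi> {..T}"
    and xi_distr: "\<And>t. t \<le> T \<Longrightarrow> distr S P (\<xi> t) = P"
    and G_measurable: "(\<lambda>(x, w). G x w) \<in>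
          borel_measurable (restrict_space borel (interior (effective_domain \<Phi>)) \<Otimes>\<^sub>M P)"
    and G_unbiased: "\<And>x. x \<in> A \<Longrightarrow> has_bochner_integral P (G x) (grad f x)"
    and G_variance: "\<And>x. x \<in> A \<Longrightarrow>
          (\<integral>\<^sup>+ w. ennreal ((dual_norm N (G x w - grad f x))\<^sup>2) \<partial>P) \<le> ennreal (\<sigma>\<^sup>2 / 2)"
    and step_size: "\<And>t. \<eta> t \<in> {0 <..< lam / (1 + lam * M)}"
begin

sublocale step: smd_step \<Phi> N r \<rho> x0 f \<tau> M lam xmin "\<eta> t" for t
  using step_size by unfold_locales auto

sublocale P: prob_space P by (rule P_prob)
sublocale S: prob_space S by (rule S_prob)

abbreviation iter :: "(nat \<Rightarrow> 'b) \<Rightarrow> nat \<Rightarrow> 'a" where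
  "iter \<equiv> smd_iterate \<Phi> r G \<eta> x0"

abbreviation wt :: "nat \<Rightarrow> real" where "wt t \<equiv> smd_step.weight \<rho> (\<eta> t)"
abbreviation stp where "stp t \<equiv> smd_step.step \<Phi> r (\<eta> t)"
abbreviation gap where "gap t \<equiv> smd_step.noise_gap M lam (\<eta> t)"

lemma iter_Suc_of_feasible:
  "iter s t \<in> U \<Longrightarrow> iter s (Suc t) = stp t (iter s t) (G (iter s t) (s t))"
  by (simp add: step.arg_min_step)

lemma iter_in_A: "iter s t \<in> A"
proof (induction t)
  case 0
  then show ?case using x0_feasible by simp
next
  case (Suc t)
  then have "iter s t \<in> U" by simp
  then show ?case by (simp only: iter_Suc_of_feasible step.step_in_A)
qed

lemma iter_in_U: "iter s t \<in> U"
  using iter_in_A[of s t] by simp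

lemma iter_Suc: "iter s (Suc t) = stp t (iter s t) (G (iter s t) (s t))"
  by (rule iter_Suc_of_feasible[OF iter_in_U])

lemma iter_cong: "(\<And>i. i < t \<Longrightarrow> s i = s' i) \<Longrightarrow> iter s t = iter s' t"
proof (induction t)
  case (Suc t)
  then have "iter s t = iter s' t" "s t = s' t" by simp_all
  then show ?case unfolding iter_Suc by simp
qed simp

lemma step_measurable:
  "(\<lambda>z. stp t (fst z) (G (fst z) (snd z)))
    \<in> measurable (restrict_space borel U \<Otimes>\<^sub>M P) (restrict_space borel U)"
proof (rule measurable_restrict_space2)
  have "(\<lambda>z. (1 / \<eta> t) *\<^sub>R egrad \<Phi> (fst z) - (case z of (x, w) \<Rightarrow> G x w))
      \<in> borel_measurable (restrict_space borel U \<Otimes>\<^sub>M P)"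
    by (intro borel_measurable_diff borel_measurable_scaleR borel_measurable_const G_measurable
        measurable_compose[OF measurable_fst egrad_measurable])
  from measurable_compose[OF this step.st.sol_measurable]
  show "(\<lambda>z. stp t (fst z) (G (fst z) (snd z))) \<in> borel_measurable (restrict_space borel U \<Otimes>\<^sub>M P)"
    unfolding step.step_def by (simp add: case_prod_beta)
qed (use step.step_in_A in auto)

lemma iter_measurable:
  "{..<t} \<subseteq> I \<Longrightarrow> (\<lambda>s. iter s t) \<in> measurable (PiM I (\<lambda>_. P)) (restrict_space borel U)"
proof (induction t)
  case 0
  show ?case using x0_feasible by (auto intro!: measurable_const)
next
  case (Suc t)
  have "(\<lambda>s. iter s t) \<in> measurable (PiM I (\<lambda>_. P)) (restrict_space borel U)"
    by (intro Suc.IH order_trans[OF _ Suc.prems]) simp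
  moreover have "(\<lambda>s. s t) \<in> measurable (PiM I (\<lambda>_. P)) P"
    using Suc.prems by (intro measurable_component_singleton) auto
  ultimately have "(\<lambda>s. (iter s t, s t)) \<in> measurable (PiM I (\<lambda>_. P)) (restrict_space borel U \<Otimes>\<^sub>M P)"
    by (rule measurable_Pair)
  from measurable_compose[OF this step_measurable[of t]] show ?case
    unfolding iter_Suc by simp
qed

lemma xi_measurable: "t \<le> T \<Longrightarrow> \<xi> t \<in> measurable S P"
  using xi_indep unfolding S.indep_vars_def by auto

abbreviation X :: "nat \<Rightarrow> 'c \<Rightarrow> 'a" where "X t \<omega> \<equiv> iter (\<lambda>i. \<xi> i \<omega>) t"

lemma X_eq_iter_restrict: "{..<t} \<subseteq> I \<Longrightarrow> X t \<omega> = iter (restrict (\<lambda>i. \<xi> i \<omega>) I) t"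
  by (intro iter_cong) auto

lemma xi_restrict_measurable:
  "I \<subseteq> {..T} \<Longrightarrow> (\<lambda>\<omega>. restrict (\<lambda>i. \<xi> i \<omega>) I) \<in> measurable S (PiM I (\<lambda>_. P))"
  using xi_measurable by (intro measurable_restrict) auto

lemma X_measurable:
  assumes "t \<le> Suc T"
  shows "X t \<in> measurable S (restrict_space borel U)"
  unfolding X_eq_iter_restrict[OF order_refl]
  using assms by (intro measurable_compose[OF xi_restrict_measurable iter_measurable]) auto

text \<open>The iterate \<open>X t\<close> is a function of the samples before \<open>t\<close> and therefore independent of
  \<open>\<xi> t\<close>. Independence is applied to the two restrictions of the sample sequence, from which
  iterate and fresh sample are read off.\<close>

lemma nn_integral_fresh_sample:
  assumes t: "t \<le> T" and h: "h \<in> borel_measurable (restrict_space borel U \<Otimes>\<^sub>M P)"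
  shows "(\<integral>\<^sup>+ \<omega>. h (X t \<omega>, \<xi> t \<omega>) \<partial>S) = (\<integral>\<^sup>+ \<omega>. (\<integral>\<^sup>+ w. h (X t \<omega>, w) \<partial>P) \<partial>S)"
proof -
  define past where "past \<omega> = restrict (\<lambda>i. \<xi> i \<omega>) {..<t}" for \<omega>
  define now where "now \<omega> = restrict (\<lambda>i. \<xi> i \<omega>) {t}" for \<omega>
  have past: "past \<in> measurable S (PiM {..<t} (\<lambda>_. P))" and now: "now \<in> measurable S (PiM {t} (\<lambda>_. P))"
    unfolding past_def now_def using t by (intro xi_restrict_measurable; auto)+
  have "S.indep_var (PiM {..<t} (\<lambda>_. P)) past (PiM {t} (\<lambda>_. P)) now"
    unfolding past_def now_def using t by (intro S.indep_var_restrict[OF xi_indep]) auto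
  then have eq: "distr S (PiM {..<t} (\<lambda>_. P)) past \<Otimes>\<^sub>M distr S (PiM {t} (\<lambda>_. P)) now
      = distr S (PiM {..<t} (\<lambda>_. P) \<Otimes>\<^sub>M PiM {t} (\<lambda>_. P)) (\<lambda>x. (past x, now x))"
    unfolding S.indep_var_distribution_eq by blast
  have "(\<lambda>z. (iter (fst z) t, snd z t))
      \<in> measurable (PiM {..<t} (\<lambda>_. P) \<Otimes>\<^sub>M PiM {t} (\<lambda>_. P)) (restrict_space borel U \<Otimes>\<^sub>M P)"
    by (intro measurable_Pair measurable_compose[OF measurable_fst iter_measurable]
        measurable_compose[OF measurable_snd measurable_component_singleton]) auto
  from measurable_compose[OF this h]
  have "(\<integral>\<^sup>+ \<omega>. h (iter (past \<omega>) t, now \<omega> t) \<partial>S)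
      = (\<integral>\<^sup>+ \<omega>. (\<integral>\<^sup>+ \<omega>'. h (iter (past \<omega>) t, now \<omega>' t) \<partial>S) \<partial>S)"
    using S.nn_integral_joint_product[OF past now eq, of "\<lambda>z. h (iter (fst z) t, snd z t)"] by simp
  moreover have "iter (past \<omega>) t = X t \<omega>" "now \<omega> t = \<xi> t \<omega>" for \<omega>
    unfolding past_def now_def by (simp_all add: X_eq_iter_restrict[OF order_refl])
  ultimately have "(\<integral>\<^sup>+ \<omega>. h (X t \<omega>, \<xi> t \<omega>) \<partial>S) = (\<integral>\<^sup>+ \<omega>. (\<integral>\<^sup>+ \<omega>'. h (X t \<omega>, \<xi> t \<omega>') \<partial>S) \<partial>S)"
    by simp
  also have "\<dots> = (\<integral>\<^sup>+ \<omega>. (\<integral>\<^sup>+ w. h (X t \<omega>, w) \<partial>P) \<partial>S)"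
  proof (rule nn_integral_cong)
    fix \<omega>
    have "X t \<omega> \<in> space (restrict_space borel U)" using iter_in_U by simp
    then have hx: "(\<lambda>w. h (X t \<omega>, w)) \<in> borel_measurable P"
      by (intro measurable_compose[OF measurable_Pair1' h])
    have "(\<integral>\<^sup>+ w. h (X t \<omega>, w) \<partial>distr S P (\<xi> t)) = (\<integral>\<^sup>+ \<omega>'. h (X t \<omega>, \<xi> t \<omega>') \<partial>S)"
      by (intro nn_integral_distr xi_measurable t) (simp add: hx)
    then show "(\<integral>\<^sup>+ \<omega>'. h (X t \<omega>, \<xi> t \<omega>') \<partial>S) = (\<integral>\<^sup>+ w. h (X t \<omega>, w) \<partial>P)"
      unfolding xi_distr[OF t] by simp
  qed
  finally show ?thesis .
qed

definition mean_gap :: "nat \<Rightarrow> ennreal" where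
  "mean_gap t = (\<integral>\<^sup>+ \<omega>. ennreal (env (X t \<omega>) - Fmin) \<partial>S)"

definition mean_div :: "nat \<Rightarrow> ennreal" where
  "mean_div t = (\<integral>\<^sup>+ \<omega>. ennreal (bdiv (prox (X t \<omega>)) (X t \<omega>)) \<partial>S)"

definition decrease :: real where "decrease = 1 / lam * (1 / lam - \<tau> - \<rho>)"

definition noise :: "nat \<Rightarrow> real" where "noise t = wt t / lam * (\<sigma>\<^sup>2 / (4 * gap t))"

lemma decrease_pos: "0 < decrease"
  unfolding decrease_def using lam_pos inverse_lam_large by simp

lemma noise_nonneg: "0 \<le> noise t"
  unfolding noise_def using lam_pos step.noise_gap_pos[of t] step.weight_pos[of t] by simp

lemma mean_descent:
  assumes t: "t \<le> T"
  shows "mean_gap (Suc t) + ennreal (decrease * wt t) * mean_div t \<le> mean_gap t + ennreal (noise t)"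
proof -
  define h where "h z = ennreal (env (stp t (fst z) (G (fst z) (snd z))) - Fmin)" for z
  have h: "h \<in> borel_measurable (restrict_space borel U \<Otimes>\<^sub>M P)"
    unfolding h_def
    using measurable_compose[OF step_measurable env_measurable] by measurable
  have X: "X t \<in> measurable S (restrict_space borel U)" using t by (intro X_measurable) simp
  define A' where "A' \<omega> = (\<integral>\<^sup>+ w. h (X t \<omega>, w) \<partial>P)" for \<omega>
  define B where "B \<omega> = ennreal (bdiv (prox (X t \<omega>)) (X t \<omega>))" for \<omega>
  have A'_meas: "A' \<in> borel_measurable S"
    unfolding A'_def by (rule measurable_compose[OF X P.borel_measurable_nn_integral_fst[OF h]])
  have B_meas: "B \<in> borel_measurable S"
    unfolding B_def
    by (intro measurable_compose[OF _ measurable_ennreal] measurable_compose[OF X bdiv_prox_measurable])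
  have gap_meas: "(\<lambda>\<omega>. ennreal (env (X t \<omega>) - Fmin)) \<in> borel_measurable S"
    by (intro measurable_compose[OF _ measurable_ennreal] borel_measurable_diff
        measurable_compose[OF X env_measurable] borel_measurable_const)
  have "mean_gap (Suc t) = (\<integral>\<^sup>+ \<omega>. h (X t \<omega>, \<xi> t \<omega>) \<partial>S)"
    unfolding mean_gap_def h_def iter_Suc by simp
  also have "\<dots> = (\<integral>\<^sup>+ \<omega>. A' \<omega> \<partial>S)"
    unfolding A'_def by (rule nn_integral_fresh_sample[OF t h])
  finally have "mean_gap (Suc t) + ennreal (decrease * wt t) * mean_div t
      = (\<integral>\<^sup>+ \<omega>. A' \<omega> \<partial>S) + (\<integral>\<^sup>+ \<omega>. ennreal (decrease * wt t) * B \<omega> \<partial>S)"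
    unfolding mean_div_def B_def[symmetric] by (simp add: nn_integral_cmult B_meas)
  also have "\<dots> = (\<integral>\<^sup>+ \<omega>. A' \<omega> + ennreal (decrease * wt t) * B \<omega> \<partial>S)"
    using A'_meas B_meas by (intro nn_integral_add[symmetric]) auto
  also have "\<dots> \<le> (\<integral>\<^sup>+ \<omega>. ennreal (env (X t \<omega>) - Fmin) + ennreal (noise t) \<partial>S)"
  proof (rule nn_integral_mono)
    fix \<omega>
    have x: "X t \<omega> \<in> A" by (rule iter_in_A)
    have "ennreal (decrease * wt t) * B \<omega> = ennreal (decrease * wt t * bdiv (prox (X t \<omega>)) (X t \<omega>))"
      unfolding B_def using decrease_pos step.weight_pos[of t] by (intro ennreal_mult'[symmetric]) simp
    then show "A' \<omega> + ennreal (decrease * wt t) * B \<omega> \<le> ennreal (env (X t \<omega>) - Fmin) + ennreal (noise t)"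
      using step.expected_envelope_descent[OF P_prob x G_unbiased[OF x] G_variance[OF x], of t]
      unfolding A'_def h_def noise_def decrease_def by simp
  qed
  also have "\<dots> = mean_gap t + ennreal (noise t)"
    unfolding mean_gap_def using gap_meas by (simp add: nn_integral_add S.emeasure_space_1)
  finally show ?thesis .
qed

text \<open>The descent is summed without subtraction, since the means are extended nonnegative numbers,
  which a priori might be infinite.\<close>

lemma mean_descent_sum:
  "n \<le> Suc T \<Longrightarrow> mean_gap n + (\<Sum>t<n. ennreal (decrease * wt t) * mean_div t)
    \<le> mean_gap 0 + (\<Sum>t<n. ennreal (noise t))"
proof (induction n)
  case (Suc n)
  have "mean_gap (Suc n) + (\<Sum>t<Suc n. ennreal (decrease * wt t) * mean_div t)
      = (mean_gap (Suc n) + ennreal (decrease * wt n) * mean_div n)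
        + (\<Sum>t<n. ennreal (decrease * wt t) * mean_div t)"
    by (simp add: ac_simps)
  also have "\<dots> \<le> (mean_gap n + ennreal (noise n)) + (\<Sum>t<n. ennreal (decrease * wt t) * mean_div t)"
    using Suc.prems by (intro add_right_mono mean_descent) simp
  also have "\<dots> = (mean_gap n + (\<Sum>t<n. ennreal (decrease * wt t) * mean_div t)) + ennreal (noise n)"
    by (simp add: ac_simps)
  also have "\<dots> \<le> (mean_gap 0 + (\<Sum>t<n. ennreal (noise t))) + ennreal (noise n)"
    using Suc by (intro add_right_mono) simp
  finally show ?case by (simp add: ac_simps)
qed simp

lemma weighted_sum_bound:
  "(\<Sum>t\<le>T. ennreal (decrease * wt t) * mean_div t)
    \<le> ennreal (env x0 - Fmin + (\<Sum>t\<le>T. noise t))"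
proof -
  have "(\<Sum>t<Suc T. ennreal (decrease * wt t) * mean_div t)
      \<le> mean_gap (Suc T) + (\<Sum>t<Suc T. ennreal (decrease * wt t) * mean_div t)"
    by (simp add: add_increasing)
  also have "\<dots> \<le> mean_gap 0 + (\<Sum>t<Suc T. ennreal (noise t))" by (rule mean_descent_sum) simp
  also have "mean_gap 0 = ennreal (env x0 - Fmin)"
    unfolding mean_gap_def by (simp add: S.emeasure_space_1)
  also have "(\<Sum>t<Suc T. ennreal (noise t)) = ennreal (\<Sum>t<Suc T. noise t)"
    by (intro sum_ennreal noise_nonneg)
  also have "ennreal (env x0 - Fmin) + ennreal (\<Sum>t<Suc T. noise t)
      = ennreal (env x0 - Fmin + (\<Sum>t<Suc T. noise t))"
    using Fmin_le_env[of x0] x0_feasible by (intro ennreal_plus[symmetric] sum_nonneg noise_nonneg) auto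
  finally show ?thesis by (simp only: lessThan_Suc_atMost)
qed

end

locale smd_random_output = smd_process +
  fixes tstar :: "'c \<Rightarrow> nat"
  assumes tstar_measurable: "tstar \<in> measurable S (count_space {..T})"
    and tstar_distr: "\<And>t. t \<le> T \<Longrightarrow> measure S {\<omega> \<in> space S. tstar \<omega> = t} =
          (\<eta> t / (1 - \<eta> t * \<rho>)) / (\<Sum>s\<le>T. \<eta> s / (1 - \<eta> s * \<rho>))"
    and tstar_indep: "prob_space.indep_set S
          (sets (vimage_algebra (space S) (\<lambda>\<omega>. \<lambda>t\<in>{..T}. \<xi> t \<omega>) (PiM {..T} (\<lambda>_. P))))
          (sets (vimage_algebra (space S) tstar (count_space {..T})))"
begin

abbreviation W :: real where "W \<equiv> \<Sum>t\<le>T. wt t"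

lemma W_pos: "0 < W"
  by (intro sum_pos step.weight_pos) auto

lemma tstar_le: "\<omega> \<in> space S \<Longrightarrow> tstar \<omega> \<le> T"
  using measurable_space[OF tstar_measurable] by auto

text \<open>The index ranges over a countable set, so joint measurability reduces to that for each fixed
  \<open>t\<close>.\<close>

lemma output_measurable:
  "(\<lambda>z. bdiv (prox (iter (fst z) (snd z))) (iter (fst z) (snd z)))
    \<in> borel_measurable (PiM {..T} (\<lambda>_. P) \<Otimes>\<^sub>M count_space {..T})"
proof (rule measurable_compose_countable'[where f = "\<lambda>t z. bdiv (prox (iter (fst z) t)) (iter (fst z) t)"])
  fix t assume "t \<in> {..T}"
  then show "(\<lambda>z. bdiv (prox (iter (fst z) t)) (iter (fst z) t))
      \<in> borel_measurable (PiM {..T} (\<lambda>_. P) \<Otimes>\<^sub>M count_space {..T})"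
    by (intro measurable_compose[OF measurable_fst]
        measurable_compose[OF iter_measurable bdiv_prox_measurable]) auto
qed (auto intro: countable_finite)

lemma X_tstar:
  "\<omega> \<in> space S \<Longrightarrow> X (tstar \<omega>) \<omega> = iter (restrict (\<lambda>i. \<xi> i \<omega>) {..T}) (tstar \<omega>)"
  using tstar_le by (intro X_eq_iter_restrict) fastforce

lemma X_tstar_div_measurable:
  "(\<lambda>\<omega>. bdiv (prox (X (tstar \<omega>) \<omega>)) (X (tstar \<omega>) \<omega>)) \<in> borel_measurable S"
proof -
  have "(\<lambda>\<omega>. (restrict (\<lambda>i. \<xi> i \<omega>) {..T}, tstar \<omega>))
      \<in> measurable S (PiM {..T} (\<lambda>_. P) \<Otimes>\<^sub>M count_space {..T})"
    by (intro measurable_Pair xi_restrict_measurable tstar_measurable order_refl)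
  from measurable_compose[OF this output_measurable] show ?thesis
    by (rule measurable_cong[THEN iffD2, rotated]) (simp add: X_tstar)
qed

text \<open>Since the index is independent of the samples, it can be integrated first, over a second copy of
  the probability space.\<close>

lemma mean_output_div:
  "(\<integral>\<^sup>+ \<omega>. ennreal (bdiv (prox (X (tstar \<omega>) \<omega>)) (X (tstar \<omega>) \<omega>)) \<partial>S)
    = (\<Sum>t\<le>T. ennreal (wt t / W) * mean_div t)"
proof -
  define h where "h z = ennreal (bdiv (prox (iter (fst z) (snd z))) (iter (fst z) (snd z)))" for z
  define \<Xi> where "\<Xi> \<omega> = restrict (\<lambda>i. \<xi> i \<omega>) {..T}" for \<omega>
  have h: "h \<in> borel_measurable (PiM {..T} (\<lambda>_. P) \<Otimes>\<^sub>M count_space {..T})"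
    unfolding h_def by (intro measurable_compose[OF output_measurable measurable_ennreal])
  have hX: "h (\<Xi> \<omega>, t) = ennreal (bdiv (prox (X t \<omega>)) (X t \<omega>))" if "t \<le> T" for t \<omega>
  proof -
    have "{..<t} \<subseteq> {..T}" using that by auto
    then show ?thesis unfolding h_def \<Xi>_def by (simp add: X_eq_iter_restrict)
  qed
  have ev: "{\<omega> \<in> space S. tstar \<omega> = t} \<in> sets S" if "t \<le> T" for t
  proof -
    have "tstar -` {t} \<inter> space S \<in> sets S"
      using that by (intro measurable_sets[OF tstar_measurable]) auto
    then show ?thesis by (simp add: vimage_def Int_def conj_commute)
  qed
  have prob: "emeasure S {\<omega> \<in> space S. tstar \<omega> = t} = ennreal (wt t / W)" if "t \<le> T" for t
    unfolding S.emeasure_eq_measure tstar_distr[OF that] step.weight_def ..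
  have "(\<integral>\<^sup>+ \<omega>. ennreal (bdiv (prox (X (tstar \<omega>) \<omega>)) (X (tstar \<omega>) \<omega>)) \<partial>S)
      = (\<integral>\<^sup>+ \<omega>. h (\<Xi> \<omega>, tstar \<omega>) \<partial>S)"
    by (intro nn_integral_cong) (simp add: hX tstar_le)
  also have "\<dots> = (\<integral>\<^sup>+ \<omega>. (\<integral>\<^sup>+ \<omega>'. h (\<Xi> \<omega>, tstar \<omega>') \<partial>S) \<partial>S)"
    unfolding \<Xi>_def
    by (rule S.nn_integral_joint_product[OF _ tstar_measurable _ h] S.distr_pair_of_indep_set
        xi_restrict_measurable tstar_measurable tstar_indep order_refl)+
  also have "\<dots> = (\<integral>\<^sup>+ \<omega>. (\<Sum>t\<le>T. h (\<Xi> \<omega>, t) * ennreal (wt t / W)) \<partial>S)"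
  proof (rule nn_integral_cong)
    fix \<omega>
    have "(\<integral>\<^sup>+ \<omega>'. h (\<Xi> \<omega>, tstar \<omega>') \<partial>S)
        = (\<integral>\<^sup>+ \<omega>'. (\<Sum>t\<le>T. h (\<Xi> \<omega>, t) * indicator {\<omega> \<in> space S. tstar \<omega> = t} \<omega>') \<partial>S)"
    proof (rule nn_integral_cong)
      fix \<omega>' assume \<omega>': "\<omega>' \<in> space S"
      have "(\<Sum>t\<le>T. h (\<Xi> \<omega>, t) * indicator {\<omega> \<in> space S. tstar \<omega> = t} \<omega>')
          = (\<Sum>t\<le>T. if t = tstar \<omega>' then h (\<Xi> \<omega>, t) else 0)"
        using \<omega>' by (intro sum.cong) (auto simp: indicator_def)
      then show "h (\<Xi> \<omega>, tstar \<omega>') = (\<Sum>t\<le>T. h (\<Xi> \<omega>, t) * indicator {\<omega> \<in> space S. tstar \<omega> = t} \<omega>')"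
        using tstar_le[OF \<omega>'] by simp
    qed
    also have "\<dots> = (\<Sum>t\<le>T. \<integral>\<^sup>+ \<omega>'. h (\<Xi> \<omega>, t) * indicator {\<omega> \<in> space S. tstar \<omega> = t} \<omega>' \<partial>S)"
      using ev by (intro nn_integral_sum) auto
    also have "\<dots> = (\<Sum>t\<le>T. h (\<Xi> \<omega>, t) * ennreal (wt t / W))"
      using ev prob by (intro sum.cong) (auto simp: nn_integral_cmult_indicator)
    finally show "(\<integral>\<^sup>+ \<omega>'. h (\<Xi> \<omega>, tstar \<omega>') \<partial>S) = (\<Sum>t\<le>T. h (\<Xi> \<omega>, t) * ennreal (wt t / W))" .
  qed
  also have "\<dots> = (\<integral>\<^sup>+ \<omega>. (\<Sum>t\<le>T. ennreal (wt t / W) * ennreal (bdiv (prox (X t \<omega>)) (X t \<omega>))) \<partial>S)"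
    by (intro nn_integral_cong sum.cong) (auto simp: hX mult.commute)
  also have "\<dots> = (\<Sum>t\<le>T. \<integral>\<^sup>+ \<omega>. ennreal (wt t / W) * ennreal (bdiv (prox (X t \<omega>)) (X t \<omega>)) \<partial>S)"
    by (intro nn_integral_sum borel_measurable_times_ennreal borel_measurable_const
        measurable_compose[OF _ measurable_ennreal]
        measurable_compose[OF X_measurable bdiv_prox_measurable]) simp
  also have "\<dots> = (\<Sum>t\<le>T. ennreal (wt t / W) * mean_div t)"
    unfolding mean_div_def
    by (intro sum.cong refl nn_integral_cmult measurable_compose[OF _ measurable_ennreal]
        measurable_compose[OF X_measurable bdiv_prox_measurable]) simp
  finally show ?thesis .
qed

lemma mean_output_div_bound:
  "(\<integral>\<^sup>+ \<omega>. ennreal (bdiv (prox (X (tstar \<omega>) \<omega>)) (X (tstar \<omega>) \<omega>)) \<partial>S)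
    \<le> ennreal (1 / (decrease * W) * (env x0 - Fmin + (\<Sum>t\<le>T. noise t)))"
proof -
  have "ennreal (wt t / W) = ennreal (1 / (decrease * W)) * ennreal (decrease * wt t)" for t
    using decrease_pos W_pos step.weight_pos[of t] by (subst ennreal_mult'[symmetric]) (simp_all)
  then have "(\<Sum>t\<le>T. ennreal (wt t / W) * mean_div t)
      = ennreal (1 / (decrease * W)) * (\<Sum>t\<le>T. ennreal (decrease * wt t) * mean_div t)"
    by (simp add: sum_distrib_left mult.assoc)
  also have "\<dots> \<le> ennreal (1 / (decrease * W)) * ennreal (env x0 - Fmin + (\<Sum>t\<le>T. noise t))"
    by (intro mult_left_mono weighted_sum_bound) simp
  also have "\<dots> = ennreal (1 / (decrease * W) * (env x0 - Fmin + (\<Sum>t\<le>T. noise t)))"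
    using decrease_pos W_pos by (intro ennreal_mult'[symmetric]) simp
  finally show ?thesis unfolding mean_output_div .
qed

lemma noise_eq:
  "noise t = \<sigma>\<^sup>2 / (4 * lam) * ((\<eta> t)\<^sup>2 / ((1 - \<eta> t * (M + 1 / lam)) * (1 - \<eta> t * \<rho>)))"
proof -
  have "0 < \<eta> t" by (rule step.eta_pos)
  moreover from this have "1 - \<eta> t * (M + 1 / lam) = \<eta> t * gap t"
    unfolding step.noise_gap_def by (simp add: algebra_simps)
  ultimately show ?thesis unfolding noise_def step.weight_def by (simp add: power2_eq_square mult_ac)
qed

lemma bound_eq:
  "1 / (decrease * W) * (env x0 - Fmin + (\<Sum>t\<le>T. noise t)) =
    lam / (1 - (\<tau> + \<rho>) * lam) * (lam * (env x0 - Fmin) / (\<Sum>t\<le>T. \<eta> t / (1 - \<eta> t * \<rho>))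
      + \<sigma>\<^sup>2 * (\<Sum>t\<le>T. (\<eta> t)\<^sup>2 / ((1 - \<eta> t * (M + 1 / lam)) * (1 - \<eta> t * \<rho>)))
        / (4 * (\<Sum>t\<le>T. \<eta> t / (1 - \<eta> t * \<rho>))))"
proof -
  define Q where "Q = (\<Sum>t\<le>T. (\<eta> t)\<^sup>2 / ((1 - \<eta> t * (M + 1 / lam)) * (1 - \<eta> t * \<rho>)))"
  define V where "V = W"
  define c where "c = 1 - (\<tau> + \<rho>) * lam"
  have V: "(\<Sum>t\<le>T. \<eta> t / (1 - \<eta> t * \<rho>)) = V" unfolding V_def step.weight_def ..
  have n: "(\<Sum>t\<le>T. noise t) = \<sigma>\<^sup>2 / (4 * lam) * Q"
    unfolding Q_def noise_eq by (rule sum_distrib_left[symmetric])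
  have c: "0 < c" using lam_small by (simp add: c_def mult.commute)
  have d: "decrease = c / lam\<^sup>2"
    unfolding decrease_def c_def using lam_pos by (simp add: field_simps power2_eq_square)
  have "0 < V" unfolding V_def by (rule W_pos)
  then show ?thesis
    unfolding V n Q_def[symmetric] V_def[symmetric] c_def[symmetric] d using c lam_pos
    by (simp add: field_simps power2_eq_square)
qed

end

theorem theorem6p2:
  fixes \<Phi> r :: "'a::euclidean_space \<Rightarrow> ereal"
    and f :: "'a \<Rightarrow> real"
    and N :: "'a \<Rightarrow> real"
    and P :: "'w measure"
    and G :: "'a \<Rightarrow> 'w \<Rightarrow> 'a"
    and S :: "'s measure"
    and \<xi> :: "nat \<Rightarrow> 's \<Rightarrow> 'w"
    and tstar :: "'s \<Rightarrow> nat"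
    and \<eta> :: "nat \<Rightarrow> real"
    and \<tau> M \<rho> \<sigma> lam :: real
    and x0 xmin :: 'a
    and T :: nat
  assumes legendre: "legendre \<Phi>"
    and f_lipschitz: "locally_lipschitz f"
    and f_diff: "\<And>x. x \<in> interior (effective_domain \<Phi>) \<inter> effective_domain r \<Longrightarrow> f differentiable at x"
    and r_not_minus_inf: "\<And>x. r x \<noteq> -\<infinity>"
    and r_closed: "closed_function r"
    and r_dom_convex: "convex (effective_domain r)"
    and ri_dom: "rel_interior (effective_domain r) \<subseteq> interior (effective_domain \<Phi>)"
    and subdiff_empty: "\<And>x. x \<notin> interior (effective_domain \<Phi>) \<Longrightarrow>
          limiting_subdifferential (\<lambda>y. r y + \<Phi> y) x = {}"
    and prob_P: "prob_space P"
    and prob_S: "prob_space S"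
    and B1_indep: "prob_space.indep_vars S (\<lambda>_. P) \<xi> {..T}"
    and B1_distr: "\<And>t. t \<le> T \<Longrightarrow> distr S P (\<xi> t) = P"
    and B2_measurable: "(\<lambda>(x, w). G x w) \<in>
          borel_measurable (restrict_space borel (interior (effective_domain \<Phi>)) \<Otimes>\<^sub>M P)"
    and B2_unbiased: "\<And>x. x \<in> interior (effective_domain \<Phi>) \<inter> effective_domain r \<Longrightarrow>
          has_bochner_integral P (G x) (grad f x)"
    and B3_nonneg: "\<tau> \<ge> 0" "M \<ge> 0"
    and B3: "\<And>x y. x \<in> interior (effective_domain \<Phi>) \<inter> effective_domain r \<Longrightarrow>
          y \<in> interior (effective_domain \<Phi>) \<inter> effective_domain r \<Longrightarrow>
          ereal (- \<tau>) * bregman \<Phi> y x \<le> ereal (f y - f x - grad f x \<bullet> (y - x)) \<and>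
          ereal (f y - f x - grad f x \<bullet> (y - x)) \<le> ereal M * bregman \<Phi> y x"
    and B4_nonneg: "\<rho> \<ge> 0"
    and B4: "weakly_convex_relative \<rho> r \<Phi>"
    and B5_norm: "is_norm N"
    and B5: "strongly_convex_function 1 N \<Phi>"
    and B6: "\<And>x. x \<in> interior (effective_domain \<Phi>) \<inter> effective_domain r \<Longrightarrow>
          (\<integral>\<^sup>+ w. ennreal ((dual_norm N (G x w - grad f x))\<^sup>2) \<partial>P) \<le> ennreal (\<sigma>\<^sup>2 / 2)"
    and lam: "lam > 0" "lam * (\<tau> + \<rho>) < 1"
    and eta: "\<And>t. \<eta> t \<in> {0 <..< lam / (1 + lam * M)}"
    and x0: "x0 \<in> interior (effective_domain \<Phi>) \<inter> effective_domain r"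
    and tstar_measurable: "tstar \<in> measurable S (count_space {..T})"
    and tstar_distr: "\<And>t. t \<le> T \<Longrightarrow> measure S {\<omega> \<in> space S. tstar \<omega> = t} =
          (\<eta> t / (1 - \<eta> t * \<rho>)) / (\<Sum>s\<le>T. \<eta> s / (1 - \<eta> s * \<rho>))"
    and tstar_indep: "prob_space.indep_set S
          (sets (vimage_algebra (space S) (\<lambda>\<omega>. \<lambda>t\<in>{..T}. \<xi> t \<omega>) (PiM {..T} (\<lambda>_. P))))
          (sets (vimage_algebra (space S) tstar (count_space {..T})))"
    and F_min: "is_arg_min (objective f r) (\<lambda>_. True) xmin"
  shows "(\<lambda>\<omega>. let x = smd_iterate \<Phi> r G \<eta> x0 (\<lambda>t. \<xi> t \<omega>) (tstar \<omega>)
               in bregman \<Phi> (bregman_prox \<Phi> lam (objective f r) x) x) \<in> borel_measurable S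
    \<and> enn2ereal (\<integral>\<^sup>+ \<omega>. e2ennreal
            (let x = smd_iterate \<Phi> r G \<eta> x0 (\<lambda>t. \<xi> t \<omega>) (tstar \<omega>)
             in bregman \<Phi> (bregman_prox \<Phi> lam (objective f r) x) x) \<partial>S)
       \<le> ereal (lam / (1 - (\<tau> + \<rho>) * lam) *
           (lam * (real_of_ereal (bregman_envelope \<Phi> lam (objective f r) x0)
                     - real_of_ereal (objective f r xmin))
              / (\<Sum>t\<le>T. \<eta> t / (1 - \<eta> t * \<rho>))
            + \<sigma>\<^sup>2 * (\<Sum>t\<le>T. (\<eta> t)\<^sup>2 / ((1 - \<eta> t * (M + 1 / lam)) * (1 - \<eta> t * \<rho>)))
              / (4 * (\<Sum>t\<le>T. \<eta> t / (1 - \<eta> t * \<rho>)))))"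
proof -
  interpret smd_random_output \<Phi> N r \<rho> x0 f \<tau> M lam xmin P G S \<xi> \<eta> \<sigma> T tstar
    by (intro smd_random_output.intro smd_process.intro composite_problem.intro regularized.intro
        legendre_kernel.intro smd_random_output_axioms.intro smd_process_axioms.intro
        composite_problem_axioms.intro regularized_axioms.intro; fact)
  have div: "bregman \<Phi> (prox x) x = ereal (bdiv (prox x) x)" if "x \<in> U" for x
    using prox_in_A[OF that] U_subset_C by (intro bregman_finite that) auto
  let ?B = "1 / (decrease * W) * (env x0 - Fmin + (\<Sum>t\<le>T. noise t))"
  have "0 \<le> ?B"
    using Fmin_le_env[of x0] x0 decrease_pos W_pos
    by (intro mult_nonneg_nonneg add_nonneg_nonneg sum_nonneg noise_nonneg) auto
  moreover have "enn2ereal (\<integral>\<^sup>+ \<omega>. ennreal (bdiv (prox (X (tstar \<omega>) \<omega>)) (X (tstar \<omega>) \<omega>)) \<partial>S)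
      \<le> enn2ereal (ennreal ?B)"
    using mean_output_div_bound by (simp add: less_eq_ennreal.rep_eq)
  ultimately have "enn2ereal (\<integral>\<^sup>+ \<omega>. ennreal (bdiv (prox (X (tstar \<omega>) \<omega>)) (X (tstar \<omega>) \<omega>)) \<partial>S) \<le> ereal ?B"
    by (simp add: enn2ereal_ennreal)
  moreover have "(\<lambda>\<omega>. ereal (bdiv (prox (X (tstar \<omega>) \<omega>)) (X (tstar \<omega>) \<omega>))) \<in> borel_measurable S"
    by (intro borel_measurable_ereal X_tstar_div_measurable)
  ultimately show ?thesis
    unfolding Let_def div[OF iter_in_U] e2ennreal_ereal bound_eq unfolding env_def by blast
qed

end
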